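(* Let $G$ be a finite group and let $\Lambda$ be an upward closed subset of $\mathrm{Sub}(G)$. The full subcategory $G\text{-}\mathrm{Tamb}_{\Lambda\text{-}\mathrm{clar}}$ of $\Lambda$-clarified $G$-Tambara functors is a reflective subcategory of the category of $G$-Tambara functors, i.e. the inclusion has a left adjoint.
   Context: Rings are commutative with unit; a $G$-ring is a ring with an action of $G$ by ring automorphisms. Let $\mathrm{bispan}(G\text{-}\mathrm{Set}^{\mathrm{fin}})$ be the category whose objects are finite $G$-sets and whose morphisms from $X$ to $Y$ are isomorphism classes of diagrams $X\leftarrow A\to B\to Y$ of finite $G$-sets, with the usual composition of bispans (polynomials), defined via pullbacks and exponential diagrams. A $G$-Tambara functor is a product-preserving functor $R:\mathrm{bispan}(G\text{-}\mathrm{Set}^{\mathrm{fin}})\to \mathrm{Set}$ such that the additive monoid $R(X)$ is a group for each finite $G$-set $X$; morphisms are natural transformations. Each $R(X)$ is a commutative ring (addition and multiplication are the transfer and norm along the fold map $X\sqcup X\to X$), and $R(G/e)$ is a $G$-ring via $\mathrm{Aut}_G(G/e)\cong G$. $\mathrm{Sub}(G)$ is the set of subgroups of $G$, ordered by $H\le H'$ if a conjugate of $H$ is a subgroup of $H'$; a subset $\Lambda$ is upward closed if $H\in\Lambda$ and $H\le H'$ imply $H'\in\Lambda$. An idempotent $d$ of a $G$-ring is of type $K$ ($K\subset G$ a subgroup) if its isotropy group is $K$ and $d\cdot gd=0$ whenever $g\notin K$. A $G$-ring is $\Lambda$-clarified if whenever it contains an idempotent of type $L$, we have $L\in\Lambda$.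 A $G$-Tambara functor $R$ is $\Lambda$-clarified if $R(G/e)$ is a $\Lambda$-clarified $G$-ring.
   Formalization: Λ is assumed non-empty: for empty Λ no Tambara functor is Λ-clarified (0 is always an idempotent of type G), so the inclusion of the empty subcategory has no left adjoint; Set is taken as the subsets of an arbitrary fixed type. *)

theory Defs
  imports "HOL-Algebra.Group_Action" "HOL-Algebra.Ring" "HOL-Library.FuncSet"
begin

section \<open>Categories, functors, adjunctions\<close>

text \<open>\<open>Cmp C X Y Z g f\<close> is the composite of \<open>f : X \<rightarrow> Y\<close> and \<open>g : Y \<rightarrow> Z\<close>. The fields only matter on
  objects and on composable arrows.\<close>

record ('o, 'm) cat =
  Obj :: "'o set"
  Hom :: "'o \<Rightarrow> 'o \<Rightarrow> 'm set"
  Ide :: "'o \<Rightarrow> 'm"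
  Cmp :: "'o \<Rightarrow> 'o \<Rightarrow> 'o \<Rightarrow> 'm \<Rightarrow> 'm \<Rightarrow> 'm"

record ('o, 'm, 'p, 'n) fnctr =
  fobj :: "'o \<Rightarrow> 'p"
  fmap :: "'o \<Rightarrow> 'o \<Rightarrow> 'm \<Rightarrow> 'n"

definition is_functor :: "('o, 'm) cat \<Rightarrow> ('p, 'n) cat \<Rightarrow> ('o, 'm, 'p, 'n) fnctr \<Rightarrow> bool" where
  "is_functor C D F \<longleftrightarrow>
     (\<forall>X\<in>Obj C. fobj F X \<in> Obj D) \<and>
     (\<forall>X\<in>Obj C. \<forall>Y\<in>Obj C. \<forall>f\<in>Hom C X Y. fmap F X Y f \<in> Hom D (fobj F X) (fobj F Y)) \<and>
     (\<forall>X\<in>Obj C. fmap F X X (Ide C X) = Ide D (fobj F X)) \<and>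
     (\<forall>X\<in>Obj C. \<forall>Y\<in>Obj C. \<forall>Z\<in>Obj C. \<forall>f\<in>Hom C X Y. \<forall>g\<in>Hom C Y Z.
        fmap F X Z (Cmp C X Y Z g f) =
        Cmp D (fobj F X) (fobj F Y) (fobj F Z) (fmap F Y Z g) (fmap F X Y f))"

definition nat_trans ::
  "('o, 'm) cat \<Rightarrow> ('p, 'n) cat \<Rightarrow> ('o, 'm, 'p, 'n) fnctr \<Rightarrow> ('o, 'm, 'p, 'n) fnctr \<Rightarrow> ('o \<Rightarrow> 'n) set" where
  "nat_trans C D F F' =
     {\<eta> \<in> (\<Pi>\<^sub>E X\<in>Obj C. Hom D (fobj F X) (fobj F' X)).
        \<forall>X\<in>Obj C. \<forall>Y\<in>Obj C. \<forall>f\<in>Hom C X Y.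
          Cmp D (fobj F X) (fobj F Y) (fobj F' Y) (\<eta> Y) (fmap F X Y f) =
          Cmp D (fobj F X) (fobj F' X) (fobj F' Y) (fmap F' X Y f) (\<eta> X)}"

definition functor_cat ::
  "('o, 'm) cat \<Rightarrow> ('p, 'n) cat \<Rightarrow> (('o, 'm, 'p, 'n) fnctr, 'o \<Rightarrow> 'n) cat" where
  "functor_cat C D =
     \<lparr>Obj = {F. is_functor C D F},
      Hom = nat_trans C D,
      Ide = (\<lambda>F. \<lambda>X\<in>Obj C. Ide D (fobj F X)),
      Cmp = (\<lambda>F F' F'' \<theta> \<eta>. \<lambda>X\<in>Obj C. Cmp D (fobj F X) (fobj F' X) (fobj F'' X) (\<theta> X) (\<eta> X))\<rparr>"

definition full_subcategory :: "('o, 'm) cat \<Rightarrow> 'o set \<Rightarrow> ('o, 'm) cat" where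
  "full_subcategory C S = C\<lparr>Obj := Obj C \<inter> S\<rparr>"

definition inclusion :: "('o, 'm, 'o, 'm) fnctr" where
  "inclusion = \<lparr>fobj = (\<lambda>X. X), fmap = (\<lambda>X Y f. f)\<rparr>"

text \<open>\<open>L : C \<rightarrow> D\<close> is left adjoint to \<open>U : D \<rightarrow> C\<close>, through a natural bijection
  \<open>\<phi> : Hom D (L X) Y \<cong> Hom C X (U Y)\<close>.\<close>

definition left_adjoint ::
  "('o, 'm) cat \<Rightarrow> ('p, 'n) cat \<Rightarrow> ('o, 'm, 'p, 'n) fnctr \<Rightarrow> ('p, 'n, 'o, 'm) fnctr \<Rightarrow> bool" where
  "left_adjoint C D L U \<longleftrightarrow> is_functor C D L \<and> is_functor D C U \<and>
     (\<exists>\<phi>. (\<forall>X\<in>Obj C. \<forall>Y\<in>Obj D.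
             bij_betw (\<phi> X Y) (Hom D (fobj L X) Y) (Hom C X (fobj U Y))) \<and>
          (\<forall>X\<in>Obj C. \<forall>X'\<in>Obj C. \<forall>Y\<in>Obj D. \<forall>Y'\<in>Obj D.
           \<forall>f\<in>Hom C X' X. \<forall>g\<in>Hom D Y Y'. \<forall>h\<in>Hom D (fobj L X) Y.
             \<phi> X' Y' (Cmp D (fobj L X') Y Y' g
                        (Cmp D (fobj L X') (fobj L X) Y h (fmap L X' X f))) =
             Cmp C X' (fobj U Y) (fobj U Y') (fmap U Y Y' g)
                (Cmp C X' X (fobj U Y) (\<phi> X Y h) f)))"

definition reflective_subcategory :: "('o, 'm) cat \<Rightarrow> 'o set \<Rightarrow> bool" where
  "reflective_subcategory C S \<longleftrightarrow> (\<exists>L. left_adjoint C (full_subcategory C S) L inclusion)"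

definition is_terminal :: "('o, 'm) cat \<Rightarrow> 'o \<Rightarrow> bool" where
  "is_terminal C T \<longleftrightarrow> T \<in> Obj C \<and> (\<forall>Z\<in>Obj C. \<exists>!h. h \<in> Hom C Z T)"

definition is_product :: "('o, 'm) cat \<Rightarrow> 'o \<Rightarrow> 'o \<Rightarrow> 'o \<Rightarrow> 'm \<Rightarrow> 'm \<Rightarrow> bool" where
  "is_product C X Y P p q \<longleftrightarrow>
     X \<in> Obj C \<and> Y \<in> Obj C \<and> P \<in> Obj C \<and> p \<in> Hom C P X \<and> q \<in> Hom C P Y \<and>
     (\<forall>Z\<in>Obj C. \<forall>f\<in>Hom C Z X. \<forall>g\<in>Hom C Z Y.
        \<exists>!h. h \<in> Hom C Z P \<and> Cmp C Z P X p h = f \<and> Cmp C Z P Y q h = g)"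

definition preserves_finite_products ::
  "('o, 'm) cat \<Rightarrow> ('p, 'n) cat \<Rightarrow> ('o, 'm, 'p, 'n) fnctr \<Rightarrow> bool" where
  "preserves_finite_products C D F \<longleftrightarrow>
     (\<forall>T. is_terminal C T \<longrightarrow> is_terminal D (fobj F T)) \<and>
     (\<forall>X Y P p q. is_product C X Y P p q \<longrightarrow>
        is_product D (fobj F X) (fobj F Y) (fobj F P) (fmap F P X p) (fmap F P Y q))"

text \<open>The category of sets, relative to the universe given by the type \<open>'a\<close>.\<close>

definition set_cat :: "('a set, 'a \<Rightarrow> 'a) cat" where
  "set_cat =
     \<lparr>Obj = UNIV,
      Hom = (\<lambda>A B. A \<rightarrow>\<^sub>E B),
      Ide = (\<lambda>A. \<lambda>x\<in>A. x),
      Cmp = (\<lambda>A B C g f. compose A g f)\<rparr>"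

section \<open>Finite G-sets\<close>

text \<open>The underlying sets of finite G-sets are taken in the type \<open>'g \<times> nat\<close>. It is infinite, so every
  finite G-set is isomorphic to one of these, and it has room for \<open>G/e\<close> itself.\<close>

record 'g gset =
  pts :: "('g \<times> nat) set"
  act :: "'g \<Rightarrow> 'g \<times> nat \<Rightarrow> 'g \<times> nat"

definition fin_gset :: "('g, 'm) monoid_scheme \<Rightarrow> 'g gset \<Rightarrow> bool" where
  "fin_gset G X \<longleftrightarrow> finite (pts X) \<and> group_action G (pts X) (act X)"

definition gmap :: "('g, 'm) monoid_scheme \<Rightarrow> 'g gset \<Rightarrow> 'g gset \<Rightarrow> ('g \<times> nat \<Rightarrow> 'g \<times> nat) \<Rightarrow> bool" where
  "gmap G X Y f \<longleftrightarrow> f \<in> pts X \<rightarrow> pts Y \<and>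
     (\<forall>g\<in>carrier G. \<forall>x\<in>pts X. f (act X g x) = act Y g (f x))"

definition free_orbit :: "('g, 'm) monoid_scheme \<Rightarrow> 'g gset" where
  "free_orbit G = \<lparr>pts = carrier G \<times> {0},
     act = (\<lambda>g. \<lambda>x\<in>carrier G \<times> {0}. (g \<otimes>\<^bsub>G\<^esub> fst x, 0))\<rparr>"

definition empty_gset :: "'g gset" where
  "empty_gset = \<lparr>pts = {}, act = (\<lambda>g. \<lambda>x\<in>{}. x)\<rparr>"

text \<open>The disjoint union tags the points of the two summands by the parity of the second component.\<close>

definition in_left :: "'g \<times> nat \<Rightarrow> 'g \<times> nat" where
  "in_left x = (fst x, 2 * snd x)"

definition in_right :: "'g \<times> nat \<Rightarrow> 'g \<times> nat" where
  "in_right x = (fst x, 2 * snd x + 1)"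

definition fold_map :: "'g \<times> nat \<Rightarrow> 'g \<times> nat" where
  "fold_map z = (fst z, snd z div 2)"

definition disj_union :: "'g gset \<Rightarrow> 'g gset \<Rightarrow> 'g gset" where
  "disj_union X Y = \<lparr>pts = in_left ` pts X \<union> in_right ` pts Y,
     act = (\<lambda>g. \<lambda>z \<in> in_left ` pts X \<union> in_right ` pts Y.
              if even (snd z) then in_left (act X g (fold_map z))
              else in_right (act Y g (fold_map z)))\<rparr>"

text \<open>The square with sides \<open>p : P \<rightarrow> A\<close>, \<open>f : A \<rightarrow> C\<close>, \<open>q : P \<rightarrow> B\<close>, \<open>g : B \<rightarrow> C\<close> is a pullback, i.e.
  \<open>(p, q)\<close> identifies \<open>P\<close> with the fibre product of \<open>f\<close> and \<open>g\<close>.\<close>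

definition is_pullback ::
  "('g, 'm) monoid_scheme \<Rightarrow> 'g gset \<Rightarrow> 'g gset \<Rightarrow> 'g gset \<Rightarrow> 'g gset \<Rightarrow>
   ('g \<times> nat \<Rightarrow> 'g \<times> nat) \<Rightarrow> ('g \<times> nat \<Rightarrow> 'g \<times> nat) \<Rightarrow>
   ('g \<times> nat \<Rightarrow> 'g \<times> nat) \<Rightarrow> ('g \<times> nat \<Rightarrow> 'g \<times> nat) \<Rightarrow> bool" where
  "is_pullback G P A B C p q f g \<longleftrightarrow>
     fin_gset G P \<and> fin_gset G A \<and> fin_gset G B \<and> fin_gset G C \<and>
     gmap G P A p \<and> gmap G P B q \<and> gmap G A C f \<and> gmap G B C g \<and>
     bij_betw (\<lambda>x. (p x, q x)) (pts P) {(a, b). a \<in> pts A \<and> b \<in> pts B \<and> f a = g b}"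

text \<open>Given \<open>h : P \<rightarrow> A\<close> and \<open>q : A \<rightarrow> B\<close>, the maps \<open>\<epsilon> : E \<rightarrow> P\<close>, \<open>\<nu> : E \<rightarrow> N\<close>, \<open>\<rho> : N \<rightarrow> B\<close> form
  an exponential diagram when \<open>E\<close> is the pullback of \<open>A\<close> and \<open>N\<close> over \<open>B\<close>, with projections \<open>h \<circ> \<epsilon>\<close>
  and \<open>\<nu>\<close>, and \<open>N\<close> is the dependent product of \<open>h\<close> along \<open>q\<close>: the points of \<open>N\<close> over \<open>b\<close> correspond to
  the sections \<open>s\<close> of \<open>h\<close> over the fibre of \<open>q\<close> at \<open>b\<close>, and \<open>\<epsilon>\<close> is the evaluation map \<open>(a, s) \<mapsto> s a\<close>.\<close>

definition is_exponential ::
  "('g, 'm) monoid_scheme \<Rightarrow> 'g gset \<Rightarrow> 'g gset \<Rightarrow> 'g gset \<Rightarrow> 'g gset \<Rightarrow> 'g gset \<Rightarrow>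
   ('g \<times> nat \<Rightarrow> 'g \<times> nat) \<Rightarrow> ('g \<times> nat \<Rightarrow> 'g \<times> nat) \<Rightarrow>
   ('g \<times> nat \<Rightarrow> 'g \<times> nat) \<Rightarrow> ('g \<times> nat \<Rightarrow> 'g \<times> nat) \<Rightarrow> ('g \<times> nat \<Rightarrow> 'g \<times> nat) \<Rightarrow> bool" where
  "is_exponential G P A B E N h q \<epsilon> \<nu> \<rho> \<longleftrightarrow>
     fin_gset G P \<and> gmap G P A h \<and> gmap G E P \<epsilon> \<and>
     is_pullback G E A N B (h \<circ> \<epsilon>) \<nu> q \<rho> \<and>
     (\<forall>b\<in>pts B. \<forall>s.
        (\<forall>a\<in>pts A. q a = b \<longrightarrow> s a \<in> pts P \<and> h (s a) = a) \<longrightarrow>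
        (\<exists>!n. n \<in> pts N \<and> \<rho> n = b \<and> (\<forall>e\<in>pts E. \<nu> e = n \<longrightarrow> \<epsilon> e = s (h (\<epsilon> e)))))"

section \<open>Bispans\<close>

text \<open>A diagram \<open>X \<leftarrow> A \<rightarrow> B \<rightarrow> Y\<close>, with maps \<open>bres\<close>, \<open>bnrm\<close>, \<open>btrf\<close> in this order; the end points \<open>X\<close> and
  \<open>Y\<close> are kept as separate parameters.\<close>

record 'g bispan =
  bA :: "'g gset"
  bB :: "'g gset"
  bres :: "'g \<times> nat \<Rightarrow> 'g \<times> nat"
  bnrm :: "'g \<times> nat \<Rightarrow> 'g \<times> nat"
  btrf :: "'g \<times> nat \<Rightarrow> 'g \<times> nat"

definition is_bispan :: "('g, 'm) monoid_scheme \<Rightarrow> 'g gset \<Rightarrow> 'g gset \<Rightarrow> 'g bispan \<Rightarrow> bool" where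
  "is_bispan G X Y S \<longleftrightarrow>
     fin_gset G X \<and> fin_gset G (bA S) \<and> fin_gset G (bB S) \<and> fin_gset G Y \<and>
     gmap G (bA S) X (bres S) \<and> gmap G (bA S) (bB S) (bnrm S) \<and> gmap G (bB S) Y (btrf S)"

definition bispan_iso :: "('g, 'm) monoid_scheme \<Rightarrow> 'g bispan \<Rightarrow> 'g bispan \<Rightarrow> bool" where
  "bispan_iso G S S' \<longleftrightarrow>
     (\<exists>\<alpha> \<beta>. gmap G (bA S) (bA S') \<alpha> \<and> bij_betw \<alpha> (pts (bA S)) (pts (bA S')) \<and>
            gmap G (bB S) (bB S') \<beta> \<and> bij_betw \<beta> (pts (bB S)) (pts (bB S')) \<and>
            (\<forall>a\<in>pts (bA S). bres S' (\<alpha> a) = bres S a \<and> bnrm S' (\<alpha> a) = \<beta> (bnrm S a)) \<and>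
            (\<forall>b\<in>pts (bB S). btrf S' (\<beta> b) = btrf S b))"

definition bispan_class ::
  "('g, 'm) monoid_scheme \<Rightarrow> 'g gset \<Rightarrow> 'g gset \<Rightarrow> 'g bispan \<Rightarrow> 'g bispan set" where
  "bispan_class G X Y S = {S'. is_bispan G X Y S' \<and> bispan_iso G S S'}"

text \<open>\<open>U\<close> is a composite of \<open>S = (X \<leftarrow> A \<rightarrow> B \<rightarrow> Y)\<close> and \<open>T = (Y \<leftarrow> C \<rightarrow> D \<rightarrow> Z)\<close>: form the
  pullback \<open>P\<close> of \<open>B\<close> and \<open>C\<close> over \<open>Y\<close>, an exponential diagram \<open>P \<leftarrow> E \<rightarrow> N \<rightarrow> D\<close> for \<open>P \<rightarrow> C \<rightarrow> D\<close>, and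
  the pullback \<open>A'\<close> of \<open>A\<close> and \<open>E\<close> over \<open>B\<close>; then \<open>U = (X \<leftarrow> A' \<rightarrow> N \<rightarrow> Z)\<close>.\<close>

definition is_composite ::
  "('g, 'm) monoid_scheme \<Rightarrow> 'g gset \<Rightarrow> 'g gset \<Rightarrow> 'g gset \<Rightarrow>
   'g bispan \<Rightarrow> 'g bispan \<Rightarrow> 'g bispan \<Rightarrow> bool" where
  "is_composite G X Y Z T S U \<longleftrightarrow>
     is_bispan G X Y S \<and> is_bispan G Y Z T \<and> is_bispan G X Z U \<and>
     (\<exists>P E p h \<epsilon> \<nu> \<rho> u v.
        is_pullback G P (bB S) (bA T) Y p h (btrf S) (bres T) \<and>
        is_exponential G P (bA T) (bB T) E (bB U) h (bnrm T) \<epsilon> \<nu> \<rho> \<and>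
        is_pullback G (bA U) (bA S) E (bB S) u v (bnrm S) (p \<circ> \<epsilon>) \<and>
        (\<forall>a\<in>pts (bA U). bres U a = bres S (u a) \<and> bnrm U a = \<nu> (v a)) \<and>
        (\<forall>n\<in>pts (bB U). btrf U n = btrf T (\<rho> n)))"

text \<open>Composites are unique up to isomorphism, so the set of all composites of all representatives
  is an isomorphism class.\<close>

definition bispan_cat :: "('g, 'm) monoid_scheme \<Rightarrow> ('g gset, 'g bispan set) cat" where
  "bispan_cat G =
     \<lparr>Obj = {X. fin_gset G X},
      Hom = (\<lambda>X Y. {bispan_class G X Y S |S. is_bispan G X Y S}),
      Ide = (\<lambda>X. bispan_class G X X
               \<lparr>bA = X, bB = X, bres = (\<lambda>x. x), bnrm = (\<lambda>x. x), btrf = (\<lambda>x. x)\<rparr>),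
      Cmp = (\<lambda>X Y Z \<tau> \<sigma>. {U. \<exists>S\<in>\<sigma>. \<exists>T\<in>\<tau>. is_composite G X Y Z T S U})\<rparr>"

text \<open>The restriction (\<open>Y\<close> to \<open>X\<close>), norm and transfer (\<open>X\<close> to \<open>Y\<close>) along \<open>f : X \<rightarrow> Y\<close>.\<close>

definition res_span where
  "res_span G X Y f = bispan_class G Y X
     \<lparr>bA = X, bB = X, bres = f, bnrm = (\<lambda>x. x), btrf = (\<lambda>x. x)\<rparr>"

definition norm_span where
  "norm_span G X Y f = bispan_class G X Y
     \<lparr>bA = X, bB = Y, bres = (\<lambda>x. x), bnrm = f, btrf = (\<lambda>x. x)\<rparr>"

definition trf_span where
  "trf_span G X Y f = bispan_class G X Y
     \<lparr>bA = X, bB = X, bres = (\<lambda>x. x), bnrm = (\<lambda>x. x), btrf = f\<rparr>"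

section \<open>Tambara functors\<close>

type_synonym ('g, 'a) bispan_functor = "('g gset, 'g bispan set, 'a set, 'a \<Rightarrow> 'a) fnctr"

text \<open>The inverse of the bijection from \<open>R (X \<squnion> X)\<close> to \<open>R X \<times> R X\<close> given by restriction to the
  summands, and the unique element of \<open>R \<emptyset>\<close>.\<close>

definition tpair ::
  "('g, 'm) monoid_scheme \<Rightarrow> ('g, 'a) bispan_functor \<Rightarrow> 'g gset \<Rightarrow> 'a \<Rightarrow> 'a \<Rightarrow> 'a" where
  "tpair G R X a b =
     (THE c. c \<in> fobj R (disj_union X X) \<and>
        fmap R (disj_union X X) X (res_span G X (disj_union X X) in_left) c = a \<and>
        fmap R (disj_union X X) X (res_span G X (disj_union X X) in_right) c = b)"

definition tpoint :: "('g, 'a) bispan_functor \<Rightarrow> 'a" where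
  "tpoint R = (THE c. c \<in> fobj R empty_gset)"

definition level_ring ::
  "('g, 'm) monoid_scheme \<Rightarrow> ('g, 'a) bispan_functor \<Rightarrow> 'g gset \<Rightarrow> 'a ring" where
  "level_ring G R X =
     \<lparr>carrier = fobj R X,
      mult = (\<lambda>a b. fmap R (disj_union X X) X (norm_span G (disj_union X X) X fold_map)
                      (tpair G R X a b)),
      one = fmap R empty_gset X (norm_span G empty_gset X (\<lambda>x. x)) (tpoint R),
      zero = fmap R empty_gset X (trf_span G empty_gset X (\<lambda>x. x)) (tpoint R),
      add = (\<lambda>a b. fmap R (disj_union X X) X (trf_span G (disj_union X X) X fold_map)
                     (tpair G R X a b))\<rparr>"

definition is_tambara :: "('g, 'm) monoid_scheme \<Rightarrow> ('g, 'a) bispan_functor \<Rightarrow> bool" where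
  "is_tambara G R \<longleftrightarrow>
     is_functor (bispan_cat G) set_cat R \<and>
     preserves_finite_products (bispan_cat G) set_cat R \<and>
     (\<forall>X. fin_gset G X \<longrightarrow> group (add_monoid (level_ring G R X)))"

definition Tamb ::
  "('g, 'm) monoid_scheme \<Rightarrow> (('g, 'a) bispan_functor, 'g gset \<Rightarrow> 'a \<Rightarrow> 'a) cat" where
  "Tamb G = full_subcategory (functor_cat (bispan_cat G) set_cat) {R. is_tambara G R}"

text \<open>\<open>G\<close> acts on \<open>R (G/e)\<close> from the left by restriction along the automorphisms \<open>x \<mapsto> x g\<close> of the
  left G-set \<open>G/e\<close>.\<close>

definition free_action ::
  "('g, 'm) monoid_scheme \<Rightarrow> ('g, 'a) bispan_functor \<Rightarrow> 'g \<Rightarrow> 'a \<Rightarrow> 'a" where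
  "free_action G R g =
     fmap R (free_orbit G) (free_orbit G)
       (res_span G (free_orbit G) (free_orbit G) (\<lambda>x. (fst x \<otimes>\<^bsub>G\<^esub> g, 0)))"

section \<open>Clarified Tambara functors\<close>

definition idempotent_of_type ::
  "('g, 'm) monoid_scheme \<Rightarrow> ('a, 'b) ring_scheme \<Rightarrow> ('g \<Rightarrow> 'a \<Rightarrow> 'a) \<Rightarrow> 'g set \<Rightarrow> 'a \<Rightarrow> bool" where
  "idempotent_of_type G A \<phi> K d \<longleftrightarrow>
     d \<in> carrier A \<and> d \<otimes>\<^bsub>A\<^esub> d = d \<and> stabilizer G \<phi> d = K \<and>
     (\<forall>g\<in>carrier G. g \<notin> K \<longrightarrow> d \<otimes>\<^bsub>A\<^esub> \<phi> g d = \<zero>\<^bsub>A\<^esub>)"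

text \<open>The idempotent \<open>0\<close> is of type \<open>G\<close>, so a \<open>\<Lambda>\<close>-clarified G-ring can only exist if
  \<open>G \<in> \<Lambda>\<close>; for upward closed \<open>\<Lambda>\<close> this means \<open>\<Lambda> \<noteq> {}\<close>.\<close>

definition clarified_ring ::
  "('g, 'm) monoid_scheme \<Rightarrow> 'g set set \<Rightarrow> ('a, 'b) ring_scheme \<Rightarrow> ('g \<Rightarrow> 'a \<Rightarrow> 'a) \<Rightarrow> bool" where
  "clarified_ring G \<Lambda> A \<phi> \<longleftrightarrow>
     (\<forall>L d. subgroup L G \<and> idempotent_of_type G A \<phi> L d \<longrightarrow> L \<in> \<Lambda>)"

definition clarified ::
  "('g, 'm) monoid_scheme \<Rightarrow> 'g set set \<Rightarrow> ('g, 'a) bispan_functor \<Rightarrow> bool" where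
  "clarified G \<Lambda> R \<longleftrightarrow> clarified_ring G \<Lambda> (level_ring G R (free_orbit G)) (free_action G R)"

definition subconjugate :: "('g, 'm) monoid_scheme \<Rightarrow> 'g set \<Rightarrow> 'g set \<Rightarrow> bool" where
  "subconjugate G H H' \<longleftrightarrow> (\<exists>g\<in>carrier G. (g <#\<^bsub>G\<^esub> H) #>\<^bsub>G\<^esub> inv\<^bsub>G\<^esub> g \<subseteq> H')"

definition upward_closed :: "('g, 'm) monoid_scheme \<Rightarrow> 'g set set \<Rightarrow> bool" where
  "upward_closed G \<Lambda> \<longleftrightarrow>
     (\<forall>H\<in>\<Lambda>. \<forall>H'. subgroup H' G \<and> subconjugate G H H' \<longrightarrow> H' \<in> \<Lambda>)"

end

theory Submission
  imports Defs
begin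

text \<open>
  The reflection of a Tambara functor \<open>R\<close> is its largest quotient that clarified functors can see: two
  elements of \<open>R X\<close> are identified when every morphism from \<open>R\<close> to a clarified Tambara functor
  identifies them. Every such morphism then factors uniquely through the quotient. Since each class is
  represented by one of its elements, the quotient lives in the same universe as \<open>R\<close>, and no product
  over the possibly large family of clarified targets has to be formed. It remains to see that the
  quotient is a clarified Tambara functor.

  It preserves finite products because all the targets do: elements of \<open>R P\<close>, for a product
  \<open>P\<close>, are identified by a morphism as soon as their two components are (\<open>joint_kernel_product\<close>). Its
  additive monoids are groups because they are homomorphic images of those of \<open>R\<close> (\<open>is_tambara_image\<close>).

  It is clarified (\<open>clarified_if_jointly_faithful\<close>): if \<open>d\<close> is an idempotent of type \<open>L\<close> at \<open>G/e\<close>, then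
  the image of \<open>d\<close> in a clarified functor is zero or again of type \<open>L\<close>. If one of the images is
  nonzero, then \<open>L \<in> \<Lambda>\<close>. Otherwise \<open>d = 0\<close>, since the morphisms to clarified functors separate the
  elements of the quotient; then \<open>L = G\<close>, which lies in every nonempty upward closed \<open>\<Lambda>\<close>.

  The last two paragraphs use that a natural transformation respects the ring structures on the levels.
  These are defined through the bijection of \<open>R (X \<squnion> X)\<close> with \<open>R X \<times> R X\<close> and through the point of \<open>R \<emptyset>\<close>,
  so disjoint unions have to be products of bispans and the empty set has to be terminal. The main
  step towards this is that composing a bispan with the restriction along an injection \<open>i\<close> cuts out the
  part of the bispan that lies over the image of \<open>i\<close> (\<open>Cmp_res_span\<close>). It also shows that \<open>G\<close> fixes the
  zero of \<open>R (G/e)\<close>.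
\<close>

section \<open>Universal arrows and reflections\<close>

definition is_category :: "('o, 'm) cat \<Rightarrow> bool" where
  "is_category C \<longleftrightarrow>
     (\<forall>X\<in>Obj C. Ide C X \<in> Hom C X X) \<and>
     (\<forall>X\<in>Obj C. \<forall>Y\<in>Obj C. \<forall>Z\<in>Obj C. \<forall>f\<in>Hom C X Y. \<forall>g\<in>Hom C Y Z. Cmp C X Y Z g f \<in> Hom C X Z) \<and>
     (\<forall>X\<in>Obj C. \<forall>Y\<in>Obj C. \<forall>f\<in>Hom C X Y.
        Cmp C X X Y f (Ide C X) = f \<and> Cmp C X Y Y (Ide C Y) f = f) \<and>
     (\<forall>W\<in>Obj C. \<forall>X\<in>Obj C. \<forall>Y\<in>Obj C. \<forall>Z\<in>Obj C. \<forall>f\<in>Hom C W X. \<forall>g\<in>Hom C X Y. \<forall>h\<in>Hom C Y Z.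
        Cmp C W X Z (Cmp C X Y Z h g) f = Cmp C W Y Z h (Cmp C W X Y g f))"

lemma is_category_set_cat: "is_category set_cat"
  unfolding is_category_def set_cat_def
  by (auto simp: compose_def fun_eq_iff PiE_iff extensional_def)

lemma is_category_functor_cat:
  assumes D: "is_category D"
  shows "is_category (functor_cat C D)"
proof -
  have ob: "fobj F X \<in> Obj D" if "is_functor C D F" "X \<in> Obj C" for F X
    using that by (simp add: is_functor_def)
  have mp: "fmap F X Y f \<in> Hom D (fobj F X) (fobj F Y)"
    if "is_functor C D F" "X \<in> Obj C" "Y \<in> Obj C" "f \<in> Hom C X Y" for F X Y f
    using that by (simp add: is_functor_def)
  have nt: "\<eta> X \<in> Hom D (fobj F X) (fobj F' X)"
    if "\<eta> \<in> nat_trans C D F F'" "X \<in> Obj C" for \<eta> F F' X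
    using that by (auto simp: nat_trans_def)
  have nat: "Cmp D (fobj F X) (fobj F Y) (fobj F' Y) (\<eta> Y) (fmap F X Y f) =
          Cmp D (fobj F X) (fobj F' X) (fobj F' Y) (fmap F' X Y f) (\<eta> X)"
    if "\<eta> \<in> nat_trans C D F F'" "X \<in> Obj C" "Y \<in> Obj C" "f \<in> Hom C X Y" for \<eta> F F' X Y f
    using that by (auto simp: nat_trans_def)
  have ext: "\<eta> \<in> extensional (Obj C)" if "\<eta> \<in> nat_trans C D F F'" for \<eta> F F'
    using that by (auto simp: nat_trans_def PiE_def)
  have idD: "Ide D X \<in> Hom D X X" if "X \<in> Obj D" for X
    using D that by (simp add: is_category_def)
  have cmpD: "Cmp D X Y Z g f \<in> Hom D X Z"
    if "X \<in> Obj D" "Y \<in> Obj D" "Z \<in> Obj D" "f \<in> Hom D X Y" "g \<in> Hom D Y Z" for X Y Z f g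
    using D that by (simp add: is_category_def)
  have unitD: "Cmp D X X Y f (Ide D X) = f" "Cmp D X Y Y (Ide D Y) f = f"
    if "X \<in> Obj D" "Y \<in> Obj D" "f \<in> Hom D X Y" for X Y f
    using D that by (simp_all add: is_category_def)
  have assD: "Cmp D W X Z (Cmp D X Y Z h g) f = Cmp D W Y Z h (Cmp D W X Y g f)"
    if "W \<in> Obj D" "X \<in> Obj D" "Y \<in> Obj D" "Z \<in> Obj D"
      "f \<in> Hom D W X" "g \<in> Hom D X Y" "h \<in> Hom D Y Z" for W X Y Z f g h
    using D that by (simp add: is_category_def)
  have comp: "(\<lambda>X\<in>Obj C. Cmp D (fobj F X) (fobj F' X) (fobj F'' X) (\<theta> X) (\<eta> X)) \<in> nat_trans C D F F''"
    if F: "is_functor C D F" "is_functor C D F'" "is_functor C D F''"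
      and n: "\<eta> \<in> nat_trans C D F F'" "\<theta> \<in> nat_trans C D F' F''" for F F' F'' \<eta> \<theta>
  proof -
    have "Cmp D (fobj F X) (fobj F Y) (fobj F'' Y)
            (Cmp D (fobj F Y) (fobj F' Y) (fobj F'' Y) (\<theta> Y) (\<eta> Y)) (fmap F X Y f) =
          Cmp D (fobj F X) (fobj F'' X) (fobj F'' Y) (fmap F'' X Y f)
            (Cmp D (fobj F X) (fobj F' X) (fobj F'' X) (\<theta> X) (\<eta> X))"
      (is "?l = ?r")
      if X: "X \<in> Obj C" "Y \<in> Obj C" "f \<in> Hom C X Y" for X Y f
    proof -
      note [simp] = ob[OF F(1) X(1)] ob[OF F(1) X(2)] ob[OF F(2) X(1)] ob[OF F(2) X(2)]
        ob[OF F(3) X(1)] ob[OF F(3) X(2)] mp[OF F(1) X] mp[OF F(2) X] mp[OF F(3) X]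
        nt[OF n(1) X(1)] nt[OF n(1) X(2)] nt[OF n(2) X(1)] nt[OF n(2) X(2)]
      have "?l = Cmp D (fobj F X) (fobj F' Y) (fobj F'' Y) (\<theta> Y)
                   (Cmp D (fobj F X) (fobj F Y) (fobj F' Y) (\<eta> Y) (fmap F X Y f))"
        by (rule assD) simp_all
      also have "\<dots> = Cmp D (fobj F X) (fobj F' Y) (fobj F'' Y) (\<theta> Y)
                   (Cmp D (fobj F X) (fobj F' X) (fobj F' Y) (fmap F' X Y f) (\<eta> X))"
        by (simp add: nat[OF n(1) X])
      also have "\<dots> = Cmp D (fobj F X) (fobj F' X) (fobj F'' Y)
                   (Cmp D (fobj F' X) (fobj F' Y) (fobj F'' Y) (\<theta> Y) (fmap F' X Y f)) (\<eta> X)"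
        by (rule assD[symmetric]) simp_all
      also have "\<dots> = Cmp D (fobj F X) (fobj F' X) (fobj F'' Y)
                   (Cmp D (fobj F' X) (fobj F'' X) (fobj F'' Y) (fmap F'' X Y f) (\<theta> X)) (\<eta> X)"
        by (simp add: nat[OF n(2) X])
      also have "\<dots> = ?r"
        by (rule assD) simp_all
      finally show ?thesis .
    qed
    then show ?thesis
      unfolding nat_trans_def by (auto intro!: cmpD ob F nt[OF n(1)] nt[OF n(2)])
  qed
  have ids: "(\<lambda>X\<in>Obj C. Ide D (fobj F X)) \<in> nat_trans C D F F" if F: "is_functor C D F" for F
    unfolding nat_trans_def by (auto intro!: idD ob F simp: unitD ob F mp)
  have unit: "(\<lambda>X\<in>Obj C. Cmp D (fobj F X) (fobj F X) (fobj F' X) (\<eta> X)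
          ((\<lambda>X\<in>Obj C. Ide D (fobj F X)) X)) = \<eta>"
       "(\<lambda>X\<in>Obj C. Cmp D (fobj F X) (fobj F' X) (fobj F' X)
          ((\<lambda>X\<in>Obj C. Ide D (fobj F' X)) X) (\<eta> X)) = \<eta>"
    if F: "is_functor C D F" "is_functor C D F'" "\<eta> \<in> nat_trans C D F F'" for F F' \<eta>
    using ext[OF F(3)] by (auto simp: fun_eq_iff extensional_def unitD ob F nt[OF F(3)])
  have assoc: "(\<lambda>X\<in>Obj C. Cmp D (fobj F X) (fobj F' X) (fobj H X)
          ((\<lambda>X\<in>Obj C. Cmp D (fobj F' X) (fobj F'' X) (fobj H X) (\<kappa> X) (\<theta> X)) X) (\<eta> X)) =
        (\<lambda>X\<in>Obj C. Cmp D (fobj F X) (fobj F'' X) (fobj H X) (\<kappa> X)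
          ((\<lambda>X\<in>Obj C. Cmp D (fobj F X) (fobj F' X) (fobj F'' X) (\<theta> X) (\<eta> X)) X))"
    if F: "is_functor C D F" "is_functor C D F'" "is_functor C D F''" "is_functor C D H"
      and n: "\<eta> \<in> nat_trans C D F F'" "\<theta> \<in> nat_trans C D F' F''" "\<kappa> \<in> nat_trans C D F'' H"
    for F F' F'' H \<eta> \<theta> \<kappa>
    by (rule restrict_ext) (simp add: assD ob F nt[OF n(1)] nt[OF n(2)] nt[OF n(3)])
  show ?thesis
    unfolding is_category_def functor_cat_def
    using comp ids unit assoc by simp
qed

lemma is_category_full_subcategory:
  "is_category C \<Longrightarrow> is_category (full_subcategory C S)"
  unfolding is_category_def full_subcategory_def by simp

text \<open>Universal arrows \<open>u X : X \<rightarrow> L X\<close> into the subcategory assemble to a left adjoint: the action of \<open>L\<close>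
  on arrows is the unique extension along \<open>u\<close>, its functoriality follows from that uniqueness, and
  precomposition with \<open>u X\<close> is the adjunction bijection.\<close>

lemma reflective_subcategoryI:
  fixes C :: "('o, 'm) cat"
  assumes C: "is_category C"
    and univ: "\<And>X. X \<in> Obj C \<Longrightarrow> \<exists>Y u. Y \<in> Obj C \<inter> S \<and> u \<in> Hom C X Y \<and>
        (\<forall>Z\<in>Obj C \<inter> S. \<forall>f\<in>Hom C X Z. \<exists>!h. h \<in> Hom C Y Z \<and> Cmp C X Y Z h u = f)"
  shows "reflective_subcategory C S"
proof -
  from univ obtain L u where Lu: "\<And>X. X \<in> Obj C \<Longrightarrow> L X \<in> Obj C \<inter> S \<and> u X \<in> Hom C X (L X) \<and>
      (\<forall>Z\<in>Obj C \<inter> S. \<forall>f\<in>Hom C X Z. \<exists>!h. h \<in> Hom C (L X) Z \<and> Cmp C X (L X) Z h (u X) = f)"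
    by metis
  have L: "L X \<in> Obj C" "L X \<in> S" and u: "u X \<in> Hom C X (L X)" if "X \<in> Obj C" for X
    using Lu that by auto
  have uniq: "\<exists>!h. h \<in> Hom C (L X) Z \<and> Cmp C X (L X) Z h (u X) = f"
    if "X \<in> Obj C" "Z \<in> Obj C" "Z \<in> S" "f \<in> Hom C X Z" for X Z f
    using Lu that by auto
  have idC: "Ide C X \<in> Hom C X X" if "X \<in> Obj C" for X
    using C that by (simp add: is_category_def)
  have cmpC: "Cmp C X Y Z g f \<in> Hom C X Z"
    if "X \<in> Obj C" "Y \<in> Obj C" "Z \<in> Obj C" "f \<in> Hom C X Y" "g \<in> Hom C Y Z" for X Y Z f g
    using C that by (simp add: is_category_def)
  have unitC: "Cmp C X X Y f (Ide C X) = f" "Cmp C X Y Y (Ide C Y) f = f"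
    if "X \<in> Obj C" "Y \<in> Obj C" "f \<in> Hom C X Y" for X Y f
    using C that by (simp_all add: is_category_def)
  have assC: "Cmp C W X Z (Cmp C X Y Z h g) f = Cmp C W Y Z h (Cmp C W X Y g f)"
    if "W \<in> Obj C" "X \<in> Obj C" "Y \<in> Obj C" "Z \<in> Obj C"
      "f \<in> Hom C W X" "g \<in> Hom C X Y" "h \<in> Hom C Y Z" for W X Y Z f g h
    using C that by (simp add: is_category_def)
  define lift where "lift = (\<lambda>X Z f. THE h. h \<in> Hom C (L X) Z \<and> Cmp C X (L X) Z h (u X) = f)"
  have lift: "lift X Z f \<in> Hom C (L X) Z" "Cmp C X (L X) Z (lift X Z f) (u X) = f"
    if "X \<in> Obj C" "Z \<in> Obj C" "Z \<in> S" "f \<in> Hom C X Z" for X Z f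
    using theI'[OF uniq[OF that]] unfolding lift_def by auto
  have lift_eq: "lift X Z f = h"
    if "X \<in> Obj C" "Z \<in> Obj C" "Z \<in> S" "h \<in> Hom C (L X) Z" "Cmp C X (L X) Z h (u X) = f" for X Z f h
    using lift[of X Z f] uniq[of X Z f] cmpC[of X "L X" Z "u X" h] L u that by blast
  define Lm where "Lm = (\<lambda>X Y f. lift X (L Y) (Cmp C X Y (L Y) (u Y) f))"
  have Lm: "Lm X Y f \<in> Hom C (L X) (L Y)"
      "Cmp C X (L X) (L Y) (Lm X Y f) (u X) = Cmp C X Y (L Y) (u Y) f"
    if "X \<in> Obj C" "Y \<in> Obj C" "f \<in> Hom C X Y" for X Y f
    unfolding Lm_def using that by (auto intro!: lift cmpC L u)
  let ?D = "full_subcategory C S"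
  let ?L = "\<lparr>fobj = L, fmap = Lm\<rparr>"
  have fL: "is_functor C ?D ?L"
  proof -
    have "Lm X X (Ide C X) = Ide C (L X)" if X: "X \<in> Obj C" for X
      unfolding Lm_def using X by (intro lift_eq) (auto simp: L u idC unitC)
    moreover have "Lm X Z (Cmp C X Y Z g f) = Cmp C (L X) (L Y) (L Z) (Lm Y Z g) (Lm X Y f)"
      if o: "X \<in> Obj C" "Y \<in> Obj C" "Z \<in> Obj C" and h: "f \<in> Hom C X Y" "g \<in> Hom C Y Z"
      for X Y Z f g
    proof -
      note [simp] = o h L u Lm(1) cmpC
      have "Cmp C X (L X) (L Z) (Cmp C (L X) (L Y) (L Z) (Lm Y Z g) (Lm X Y f)) (u X) =
            Cmp C X (L Y) (L Z) (Lm Y Z g) (Cmp C X (L X) (L Y) (Lm X Y f) (u X))"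
        by (intro assC) simp_all
      also have "\<dots> = Cmp C X (L Y) (L Z) (Lm Y Z g) (Cmp C X Y (L Y) (u Y) f)"
        by (simp add: Lm(2))
      also have "\<dots> = Cmp C X Y (L Z) (Cmp C Y (L Y) (L Z) (Lm Y Z g) (u Y)) f"
        by (intro assC[symmetric]) simp_all
      also have "\<dots> = Cmp C X Y (L Z) (Cmp C Y Z (L Z) (u Z) g) f"
        by (simp add: Lm(2))
      also have "\<dots> = Cmp C X Z (L Z) (u Z) (Cmp C X Y Z g f)"
        by (intro assC) simp_all
      finally have "lift X (L Z) (Cmp C X Z (L Z) (u Z) (Cmp C X Y Z g f)) =
          Cmp C (L X) (L Y) (L Z) (Lm Y Z g) (Lm X Y f)"
        by (intro lift_eq) simp_all
      then show ?thesis
        by (simp add: Lm_def)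
    qed
    ultimately show ?thesis
      unfolding is_functor_def full_subcategory_def using L Lm by simp
  qed
  have fU: "is_functor ?D C inclusion"
    unfolding is_functor_def full_subcategory_def inclusion_def by simp
  define \<phi> where "\<phi> = (\<lambda>X Z h. Cmp C X (L X) Z h (u X))"
  have bij: "bij_betw (\<phi> X Z) (Hom C (L X) Z) (Hom C X Z)"
    if "X \<in> Obj C" "Z \<in> Obj C" "Z \<in> S" for X Z
  proof (rule bij_betwI[where g = "lift X Z"])
    show "\<phi> X Z \<in> Hom C (L X) Z \<rightarrow> Hom C X Z" "lift X Z \<in> Hom C X Z \<rightarrow> Hom C (L X) Z"
      using that by (auto simp: \<phi>_def intro!: cmpC lift L u)
    show "lift X Z (\<phi> X Z h) = h" if "h \<in> Hom C (L X) Z" for h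
      unfolding \<phi>_def using that \<open>X \<in> Obj C\<close> \<open>Z \<in> Obj C\<close> \<open>Z \<in> S\<close> by (intro lift_eq) auto
    show "\<phi> X Z (lift X Z f) = f" if "f \<in> Hom C X Z" for f
      unfolding \<phi>_def using that \<open>X \<in> Obj C\<close> \<open>Z \<in> Obj C\<close> \<open>Z \<in> S\<close> by (intro lift)
  qed
  have nat: "\<phi> X' Z' (Cmp C (L X') Z Z' g (Cmp C (L X') (L X) Z h (Lm X' X f))) =
        Cmp C X' Z Z' g (Cmp C X' X Z (\<phi> X Z h) f)"
    if o: "X \<in> Obj C" "X' \<in> Obj C" "Z \<in> Obj C" "Z' \<in> Obj C"
      and h: "f \<in> Hom C X' X" "g \<in> Hom C Z Z'" "h \<in> Hom C (L X) Z" for X X' Z Z' f g h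
  proof -
    note [simp] = o h L u Lm(1) cmpC
    have "\<phi> X' Z' (Cmp C (L X') Z Z' g (Cmp C (L X') (L X) Z h (Lm X' X f))) =
        Cmp C X' Z Z' g (Cmp C X' (L X') Z (Cmp C (L X') (L X) Z h (Lm X' X f)) (u X'))"
      unfolding \<phi>_def by (intro assC) simp_all
    also have "Cmp C X' (L X') Z (Cmp C (L X') (L X) Z h (Lm X' X f)) (u X') =
        Cmp C X' (L X) Z h (Cmp C X' (L X') (L X) (Lm X' X f) (u X'))"
      by (intro assC) simp_all
    also have "\<dots> = Cmp C X' (L X) Z h (Cmp C X' X (L X) (u X) f)"
      by (simp add: Lm(2))
    also have "\<dots> = Cmp C X' X Z (\<phi> X Z h) f"
      unfolding \<phi>_def by (intro assC[symmetric]) simp_all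
    finally show ?thesis .
  qed
  have "left_adjoint C ?D ?L inclusion"
    unfolding left_adjoint_def
  proof (intro conjI fL fU exI[of _ \<phi>])
  qed (use bij nat in \<open>simp_all add: full_subcategory_def inclusion_def\<close>)
  then show ?thesis
    unfolding reflective_subcategory_def by blast
qed

section \<open>Quotients of set-valued functors\<close>

lemma fmap_set_cat:
  assumes "is_functor C set_cat F" "X \<in> Obj C" "Y \<in> Obj C" "f \<in> Hom C X Y"
  shows "fmap F X Y f \<in> fobj F X \<rightarrow>\<^sub>E fobj F Y"
  using assms by (auto simp: is_functor_def set_cat_def)

lemma fmap_set_cat_mem:
  assumes "is_functor C set_cat F" "X \<in> Obj C" "Y \<in> Obj C" "f \<in> Hom C X Y" "a \<in> fobj F X"
  shows "fmap F X Y f a \<in> fobj F Y"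
  using fmap_set_cat[OF assms(1-4)] assms(5) by auto

lemma fmap_set_cat_Cmp:
  assumes "is_functor C set_cat F" "X \<in> Obj C" "Y \<in> Obj C" "Z \<in> Obj C"
    "f \<in> Hom C X Y" "g \<in> Hom C Y Z" "a \<in> fobj F X"
  shows "fmap F X Z (Cmp C X Y Z g f) a = fmap F Y Z g (fmap F X Y f a)"
  using assms by (simp add: is_functor_def set_cat_def compose_def)

lemma fmap_set_cat_Ide:
  assumes "is_functor C set_cat F" "X \<in> Obj C" "a \<in> fobj F X"
  shows "fmap F X X (Ide C X) a = a"
  using assms by (simp add: is_functor_def set_cat_def)

lemma nat_trans_mem:
  assumes "\<eta> \<in> nat_trans C set_cat F F'" "X \<in> Obj C" "a \<in> fobj F X"
  shows "\<eta> X a \<in> fobj F' X"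
  using assms by (auto simp: nat_trans_def set_cat_def)

lemma nat_trans_natural:
  assumes "\<eta> \<in> nat_trans C set_cat F F'" "X \<in> Obj C" "Y \<in> Obj C" "f \<in> Hom C X Y" "a \<in> fobj F X"
  shows "\<eta> Y (fmap F X Y f a) = fmap F' X Y f (\<eta> X a)"
proof -
  have "compose (fobj F X) (\<eta> Y) (fmap F X Y f) a = compose (fobj F X) (fmap F' X Y f) (\<eta> X) a"
    using assms by (simp add: nat_trans_def set_cat_def)
  then show ?thesis using assms(5) by (simp add: compose_def)
qed

lemma nat_trans_set_catI:
  assumes "\<And>X. X \<in> Obj C \<Longrightarrow> \<eta> X \<in> fobj F X \<rightarrow>\<^sub>E fobj F' X" "\<eta> \<in> extensional (Obj C)"
    and "\<And>X Y f a. \<lbrakk>X \<in> Obj C; Y \<in> Obj C; f \<in> Hom C X Y; a \<in> fobj F X\<rbrakk>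
           \<Longrightarrow> \<eta> Y (fmap F X Y f a) = fmap F' X Y f (\<eta> X a)"
  shows "\<eta> \<in> nat_trans C set_cat F F'"
  unfolding nat_trans_def using assms by (auto simp: set_cat_def compose_def PiE_iff)

lemma is_functor_set_catI:
  assumes "\<And>X Y f a. \<lbrakk>X \<in> Obj C; Y \<in> Obj C; f \<in> Hom C X Y; a \<in> fobj F X\<rbrakk> \<Longrightarrow> fmap F X Y f a \<in> fobj F Y"
    and "\<And>X Y f. fmap F X Y f \<in> extensional (fobj F X)"
    and "\<And>X a. \<lbrakk>X \<in> Obj C; a \<in> fobj F X\<rbrakk> \<Longrightarrow> fmap F X X (Ide C X) a = a"
    and "\<And>X Y Z f g a. \<lbrakk>X \<in> Obj C; Y \<in> Obj C; Z \<in> Obj C; f \<in> Hom C X Y; g \<in> Hom C Y Z; a \<in> fobj F X\<rbrakk>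
           \<Longrightarrow> fmap F X Z (Cmp C X Y Z g f) a = fmap F Y Z g (fmap F X Y f a)"
  shows "is_functor C set_cat F"
proof -
  have "fmap F X X (Ide C X) = (\<lambda>x\<in>fobj F X. x)" if "X \<in> Obj C" for X
    using assms(2)[of X X "Ide C X"] assms(3)[OF that]
    by (auto simp: fun_eq_iff extensional_def)
  moreover have "fmap F X Z (Cmp C X Y Z g f) = compose (fobj F X) (fmap F Y Z g) (fmap F X Y f)"
    if "X \<in> Obj C" "Y \<in> Obj C" "Z \<in> Obj C" "f \<in> Hom C X Y" "g \<in> Hom C Y Z" for X Y Z f g
    using assms(2)[of X Z "Cmp C X Y Z g f"] assms(4)[OF that]
    by (auto simp: fun_eq_iff compose_def extensional_def)
  ultimately show ?thesis
    unfolding is_functor_def using assms(1,2) by (auto simp: set_cat_def PiE_iff)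
qed

text \<open>Elements of a set are maps out of a one-point set, so it suffices to test the universal property of
  a product on one point; the maps out of a general set are then determined pointwise.\<close>

lemma is_product_set_cat_iff:
  "is_product set_cat A B P p q \<longleftrightarrow>
     p \<in> P \<rightarrow>\<^sub>E A \<and> q \<in> P \<rightarrow>\<^sub>E B \<and> (\<forall>a\<in>A. \<forall>b\<in>B. \<exists>!c. c \<in> P \<and> p c = a \<and> q c = b)"
proof
  assume pr: "is_product set_cat A B P p q"
  then have pq: "p \<in> P \<rightarrow>\<^sub>E A" "q \<in> P \<rightarrow>\<^sub>E B"
    and un: "\<And>(Z :: 'a set) f g. f \<in> Z \<rightarrow>\<^sub>E A \<Longrightarrow> g \<in> Z \<rightarrow>\<^sub>E B \<Longrightarrow>
        \<exists>!h. h \<in> Z \<rightarrow>\<^sub>E P \<and> compose Z p h = f \<and> compose Z q h = g"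
    by (auto simp: is_product_def set_cat_def)
  have "\<exists>!c. c \<in> P \<and> p c = a \<and> q c = b" if ab: "a \<in> A" "b \<in> B" for a b
  proof -
    \<comment> \<open>the one-point set that tests the universal property; any point of \<open>'a\<close> would do\<close>
    let ?Z = "{undefined} :: 'a set"
    let ?pt = "\<lambda>c :: 'a. \<lambda>z\<in>?Z. c"
    have pt: "compose ?Z r (?pt c) = ?pt d \<longleftrightarrow> r c = d" for r c d
      by (auto simp: compose_def fun_eq_iff)
    define Q where "Q = (\<lambda>h. h \<in> ?Z \<rightarrow>\<^sub>E P \<and> compose ?Z p h = ?pt a \<and> compose ?Z q h = ?pt b)"
    have ex: "\<exists>!h. Q h"
      unfolding Q_def by (rule un) (use ab in auto)
    then obtain h where Qh: "Q h"
      by (rule ex1E)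
    then have h: "h \<in> ?Z \<rightarrow>\<^sub>E P" "compose ?Z p h = ?pt a" "compose ?Z q h = ?pt b"
      by (simp_all only: Q_def)
    define c where "c = h undefined"
    have hc: "h = ?pt c"
      using h(1) by (auto simp: c_def fun_eq_iff PiE_iff extensional_def)
    have c: "c \<in> P" "p c = a" "q c = b"
      using h(1) h(2,3)[unfolded hc pt] by (auto simp: c_def)
    moreover have "c' = c" if c': "c' \<in> P" "p c' = a" "q c' = b" for c'
    proof -
      have "?pt c' \<in> ?Z \<rightarrow>\<^sub>E P" using c' by auto
      then have "Q (?pt c')"
        using c' by (simp only: Q_def pt)
      with ex Qh have "?pt c' = h"
        by metis
      then have "?pt c' = ?pt c"
        by (simp only: hc)
      then show ?thesis by (metis restrict_apply singletonI)
    qed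
    ultimately show ?thesis by blast
  qed
  with pq show "p \<in> P \<rightarrow>\<^sub>E A \<and> q \<in> P \<rightarrow>\<^sub>E B \<and> (\<forall>a\<in>A. \<forall>b\<in>B. \<exists>!c. c \<in> P \<and> p c = a \<and> q c = b)"
    by (intro conjI ballI)
next
  assume r: "p \<in> P \<rightarrow>\<^sub>E A \<and> q \<in> P \<rightarrow>\<^sub>E B \<and> (\<forall>a\<in>A. \<forall>b\<in>B. \<exists>!c. c \<in> P \<and> p c = a \<and> q c = b)"
  have "\<exists>!h. h \<in> Z \<rightarrow>\<^sub>E P \<and> compose Z p h = f \<and> compose Z q h = g"
    if fg: "f \<in> Z \<rightarrow>\<^sub>E A" "g \<in> Z \<rightarrow>\<^sub>E B" for Z :: "'a set" and f g
  proof -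
    have "\<exists>!c. c \<in> P \<and> p c = f z \<and> q c = g z" if "z \<in> Z" for z
      using r fg that by (auto simp: PiE_iff)
    then obtain h where h: "\<And>z. z \<in> Z \<Longrightarrow> h z \<in> P \<and> p (h z) = f z \<and> q (h z) = g z"
      and hu: "\<And>z c. z \<in> Z \<Longrightarrow> c \<in> P \<Longrightarrow> p c = f z \<Longrightarrow> q c = g z \<Longrightarrow> c = h z"
      by metis
    show ?thesis
    proof (rule ex1I[of _ "restrict h Z"])
      show "restrict h Z \<in> Z \<rightarrow>\<^sub>E P \<and> compose Z p (restrict h Z) = f \<and> compose Z q (restrict h Z) = g"
        using h fg by (auto simp: compose_def fun_eq_iff PiE_iff extensional_def)
      fix k assume k: "k \<in> Z \<rightarrow>\<^sub>E P \<and> compose Z p k = f \<and> compose Z q k = g"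
      have "k z = h z" if "z \<in> Z" for z
        using k that by (intro hu) (auto simp: compose_def)
      then show "k = restrict h Z"
        using k by (auto simp: fun_eq_iff PiE_iff extensional_def)
    qed
  qed
  then show "is_product set_cat A B P p q"
    using r by (simp add: is_product_def set_cat_def)
qed

lemma is_terminal_set_cat_iff:
  "is_terminal set_cat T \<longleftrightarrow> (\<exists>t. T = {t})"
proof
  assume t: "is_terminal set_cat T"
  then have un: "\<exists>!h. h \<in> Z \<rightarrow>\<^sub>E T" for Z :: "'a set"
    by (simp add: is_terminal_def set_cat_def)
  let ?Z = "{undefined} :: 'a set"
  from un[of ?Z] obtain h where h: "h \<in> ?Z \<rightarrow>\<^sub>E T" by blast
  have "t = h undefined" if "t \<in> T" for t
  proof -
    have "(\<lambda>z\<in>?Z. t) \<in> ?Z \<rightarrow>\<^sub>E T" using that by auto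
    with un[of ?Z] h have "(\<lambda>z\<in>?Z. t) = h"
      by metis
    then show ?thesis by auto
  qed
  moreover have "h undefined \<in> T" using h by auto
  ultimately show "\<exists>t. T = {t}" by blast
next
  assume "\<exists>t. T = {t}"
  then obtain t where "T = {t}" ..
  have "\<exists>!h. h \<in> Z \<rightarrow>\<^sub>E T" for Z :: "'a set"
    by (rule ex1I[of _ "\<lambda>z\<in>Z. t"]) (auto simp: \<open>T = {t}\<close> fun_eq_iff PiE_iff extensional_def)
  then show "is_terminal set_cat T"
    by (simp add: is_terminal_def set_cat_def)
qed

text \<open>A congruence on a set-valued functor is an equivalence relation on each of its values that all
  arrows respect. Its quotient must again take values in sets of elements of \<open>'a\<close>, so a class is
  represented by one of its elements instead of by a set of elements. \<open>rep X a\<close> depends only on the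
  class of \<open>a\<close>, because it is chosen from the set of elements related to \<open>a\<close>.\<close>

locale functor_congruence =
  fixes C :: "('o, 'm) cat" and F :: "('o, 'm, 'a set, 'a \<Rightarrow> 'a) fnctr"
    and \<theta> :: "'o \<Rightarrow> ('a \<times> 'a) set"
  assumes is_functor: "is_functor C set_cat F"
    and equiv_rel: "X \<in> Obj C \<Longrightarrow> equiv (fobj F X) (\<theta> X)"
    and compatible: "\<lbrakk>X \<in> Obj C; Y \<in> Obj C; f \<in> Hom C X Y; (a, b) \<in> \<theta> X\<rbrakk>
       \<Longrightarrow> (fmap F X Y f a, fmap F X Y f b) \<in> \<theta> Y"
begin

definition rep :: "'o \<Rightarrow> 'a \<Rightarrow> 'a" where
  "rep X a = (SOME b. (a, b) \<in> \<theta> X)"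

definition quot :: "('o, 'm, 'a set, 'a \<Rightarrow> 'a) fnctr" where
  "quot = \<lparr>fobj = (\<lambda>X. rep X ` fobj F X),
     fmap = (\<lambda>X Y f. \<lambda>a \<in> rep X ` fobj F X. rep Y (fmap F X Y f a))\<rparr>"

definition proj :: "'o \<Rightarrow> 'a \<Rightarrow> 'a" where
  "proj = (\<lambda>X\<in>Obj C. \<lambda>a\<in>fobj F X. rep X a)"

lemma rep_related:
  assumes "X \<in> Obj C" "a \<in> fobj F X"
  shows "(a, rep X a) \<in> \<theta> X"
proof -
  have "(a, a) \<in> \<theta> X"
    using equiv_rel[OF assms(1)] assms(2) by (auto simp: equiv_def refl_on_def)
  then show ?thesis unfolding rep_def by (rule someI)
qed

lemma rep_mem: "X \<in> Obj C \<Longrightarrow> a \<in> fobj F X \<Longrightarrow> rep X a \<in> fobj F X"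
  using rep_related equiv_rel by (metis equiv_class_eq_iff)

lemma rep_eq_iff:
  assumes "X \<in> Obj C" "a \<in> fobj F X" "b \<in> fobj F X"
  shows "rep X a = rep X b \<longleftrightarrow> (a, b) \<in> \<theta> X"
proof
  assume "rep X a = rep X b"
  then show "(a, b) \<in> \<theta> X"
    using rep_related[OF assms(1,2)] rep_related[OF assms(1,3)] equiv_rel[OF assms(1)]
    by (metis equivE symE transE)
next
  assume "(a, b) \<in> \<theta> X"
  then have "(a, c) \<in> \<theta> X \<longleftrightarrow> (b, c) \<in> \<theta> X" for c
    using equiv_rel[OF assms(1)] by (metis equivE symE transE)
  then show "rep X a = rep X b" by (simp add: rep_def)
qed

lemma rep_rep: "X \<in> Obj C \<Longrightarrow> a \<in> fobj F X \<Longrightarrow> rep X (rep X a) = rep X a"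
  using rep_eq_iff rep_related rep_mem by metis

lemma proj_apply: "X \<in> Obj C \<Longrightarrow> a \<in> fobj F X \<Longrightarrow> proj X a = rep X a"
  by (simp add: proj_def)

lemma proj_eq_iff:
  "X \<in> Obj C \<Longrightarrow> a \<in> fobj F X \<Longrightarrow> b \<in> fobj F X \<Longrightarrow> proj X a = proj X b \<longleftrightarrow> (a, b) \<in> \<theta> X"
  by (simp add: proj_apply rep_eq_iff)

lemma proj_surj: "X \<in> Obj C \<Longrightarrow> fobj quot X = proj X ` fobj F X"
  by (simp add: proj_def quot_def)

lemma fmap_rep:
  assumes "X \<in> Obj C" "Y \<in> Obj C" "f \<in> Hom C X Y" "a \<in> fobj F X"
  shows "rep Y (fmap F X Y f (rep X a)) = rep Y (fmap F X Y f a)"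
proof -
  have "(fmap F X Y f a, fmap F X Y f (rep X a)) \<in> \<theta> Y"
    by (intro compatible rep_related assms)
  then show ?thesis
    using rep_eq_iff[OF assms(2)] fmap_set_cat_mem[OF is_functor assms(1-3)] rep_mem assms by metis
qed

lemma fmap_quot:
  assumes "X \<in> Obj C" "Y \<in> Obj C" "f \<in> Hom C X Y" "a \<in> fobj F X"
  shows "fmap quot X Y f (rep X a) = rep Y (fmap F X Y f a)"
  using assms by (simp add: quot_def fmap_rep)

lemma is_functor_quot: "is_functor C set_cat quot"
proof (rule is_functor_set_catI)
  show "fmap quot X Y f a \<in> fobj quot Y"
    if "X \<in> Obj C" "Y \<in> Obj C" "f \<in> Hom C X Y" "a \<in> fobj quot X" for X Y f a
    using that fmap_set_cat_mem[OF is_functor that(1-3)] rep_mem by (auto simp: quot_def)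
  show "fmap quot X Y f \<in> extensional (fobj quot X)" for X Y f
    by (simp add: quot_def)
  show "fmap quot X X (Ide C X) a = a" if "X \<in> Obj C" "a \<in> fobj quot X" for X a
    using that fmap_set_cat_Ide[OF is_functor that(1)] rep_mem rep_rep by (auto simp: quot_def)
  show "fmap quot X Z (Cmp C X Y Z g f) a = fmap quot Y Z g (fmap quot X Y f a)"
    if "X \<in> Obj C" "Y \<in> Obj C" "Z \<in> Obj C" "f \<in> Hom C X Y" "g \<in> Hom C Y Z" and aq: "a \<in> fobj quot X"
    for X Y Z f g a
  proof -
    obtain b where b: "a = rep X b" "b \<in> fobj F X" using aq by (auto simp: quot_def)
    let ?a = "rep X b"
    have a: "?a \<in> fobj F X" using b rep_mem that by simp
    have fa: "fmap F X Y f ?a \<in> fobj F Y"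
      by (rule fmap_set_cat_mem[OF is_functor]) (use that a in auto)
    have "fmap quot X Z (Cmp C X Y Z g f) ?a = rep Z (fmap F X Z (Cmp C X Y Z g f) ?a)"
      using b by (simp add: quot_def)
    also have "\<dots> = rep Z (fmap F Y Z g (fmap F X Y f ?a))"
      using that a by (simp add: fmap_set_cat_Cmp[OF is_functor])
    also have "\<dots> = fmap quot Y Z g (rep Y (fmap F X Y f ?a))"
      using that fa by (simp add: fmap_quot)
    also have "rep Y (fmap F X Y f ?a) = fmap quot X Y f ?a"
      using b by (simp add: quot_def)
    finally show ?thesis using b by simp
  qed
qed

lemma proj_nat_trans: "proj \<in> nat_trans C set_cat F quot"
proof (rule nat_trans_set_catI)
  show "proj Y (fmap F X Y f a) = fmap quot X Y f (proj X a)"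
    if "X \<in> Obj C" "Y \<in> Obj C" "f \<in> Hom C X Y" "a \<in> fobj F X" for X Y f a
    using that fmap_set_cat_mem[OF is_functor that] by (simp add: proj_apply fmap_quot)
qed (auto simp: proj_def quot_def)

text \<open>The factorization is \<open>\<eta>\<close> itself, restricted to the representatives.\<close>

lemma proj_universal:
  assumes \<eta>: "\<eta> \<in> nat_trans C set_cat F S"
    and const: "\<And>X a b. X \<in> Obj C \<Longrightarrow> (a, b) \<in> \<theta> X \<Longrightarrow> \<eta> X a = \<eta> X b"
  shows "\<exists>!h. h \<in> nat_trans C set_cat quot S \<and> Cmp (functor_cat C set_cat) F quot S h proj = \<eta>"
proof -
  define h where "h = (\<lambda>X\<in>Obj C. \<lambda>a\<in>fobj quot X. \<eta> X a)"
  have h_rep: "h X (rep X a) = \<eta> X a" if "X \<in> Obj C" "a \<in> fobj F X" for X a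
    using that const[OF that(1) rep_related[OF that]] by (simp add: h_def quot_def)
  have \<eta>X: "\<eta> X \<in> fobj F X \<rightarrow>\<^sub>E fobj S X" if "X \<in> Obj C" for X
    using \<eta> that by (auto simp: nat_trans_def set_cat_def)
  have \<eta>E: "\<eta> \<in> extensional (Obj C)"
    using \<eta> by (auto simp: nat_trans_def PiE_def)
  have h: "h \<in> nat_trans C set_cat quot S"
  proof (rule nat_trans_set_catI)
    show "h X \<in> fobj quot X \<rightarrow>\<^sub>E fobj S X" if "X \<in> Obj C" for X
      using that \<eta>X[OF that] rep_mem by (auto simp: h_def quot_def)
    show "h Y (fmap quot X Y f a) = fmap S X Y f (h X a)"
      if o: "X \<in> Obj C" "Y \<in> Obj C" "f \<in> Hom C X Y" and a: "a \<in> fobj quot X" for X Y f a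
    proof -
      obtain b where b: "a = rep X b" "b \<in> fobj F X" using a by (auto simp: quot_def)
      show ?thesis
        using o b fmap_set_cat_mem[OF is_functor o b(2)]
        by (simp add: fmap_quot h_rep nat_trans_natural[OF \<eta>])
    qed
  qed (auto simp: h_def)
  have cmp: "Cmp (functor_cat C set_cat) F quot S k proj = \<eta> \<longleftrightarrow>
      (\<forall>X\<in>Obj C. \<forall>a\<in>fobj F X. k X (rep X a) = \<eta> X a)" for k
  proof -
    have "Cmp (functor_cat C set_cat) F quot S k proj = (\<lambda>X\<in>Obj C. compose (fobj F X) (k X) (proj X))"
      by (simp add: functor_cat_def set_cat_def)
    then have "Cmp (functor_cat C set_cat) F quot S k proj = \<eta> \<longleftrightarrow>
        (\<forall>X\<in>Obj C. compose (fobj F X) (k X) (proj X) = \<eta> X)"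
      using \<eta>E by (auto simp: fun_eq_iff extensional_def)
    also have "\<dots> \<longleftrightarrow> (\<forall>X\<in>Obj C. \<forall>a\<in>fobj F X. k X (rep X a) = \<eta> X a)"
    proof (intro ball_cong refl iffI ballI)
      fix X a assume "X \<in> Obj C" "a \<in> fobj F X" "compose (fobj F X) (k X) (proj X) = \<eta> X"
      then show "k X (rep X a) = \<eta> X a"
        by (metis compose_eq proj_apply)
    next
      fix X assume X: "X \<in> Obj C" and k: "\<forall>a\<in>fobj F X. k X (rep X a) = \<eta> X a"
      have "\<eta> X \<in> extensional (fobj F X)"
        using \<eta>X[OF X] by (simp add: PiE_def)
      then show "compose (fobj F X) (k X) (proj X) = \<eta> X"
        by (rule extensionalityI[OF compose_extensional]) (simp add: compose_eq proj_apply X k)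
    qed
    finally show ?thesis .
  qed
  show ?thesis
  proof (rule ex1I[of _ h])
    show "h \<in> nat_trans C set_cat quot S \<and> Cmp (functor_cat C set_cat) F quot S h proj = \<eta>"
      using h h_rep cmp by auto
    fix k assume k: "k \<in> nat_trans C set_cat quot S \<and> Cmp (functor_cat C set_cat) F quot S k proj = \<eta>"
    have kh: "k X a = h X a" if "X \<in> Obj C" "a \<in> fobj quot X" for X a
      using k cmp h_rep that by (auto simp: quot_def)
    have PiE: "l X \<in> fobj quot X \<rightarrow>\<^sub>E fobj S X" "l \<in> extensional (Obj C)"
      if "l \<in> nat_trans C set_cat quot S" "X \<in> Obj C" for l X
      using that by (auto simp: nat_trans_def set_cat_def PiE_def)
    have "k X = h X" if "X \<in> Obj C" for X
      using PiE(1)[of k X] PiE(1)[of h X] k h kh that by (intro PiE_ext) auto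
    moreover have "k \<in> extensional (Obj C)" "h \<in> extensional (Obj C)"
      using k h by (auto simp: nat_trans_def PiE_def)
    ultimately show "k = h"
      by (rule extensionalityI[rotated 2])
  qed
qed

text \<open>Existence of pairs is inherited from \<open>F\<close> by lifting both components to \<open>F\<close>. Uniqueness is what the
  second hypothesis provides: it makes the relation on a product the product of the relations on the
  factors.\<close>

lemma preserves_finite_products_quot:
  assumes pres: "preserves_finite_products C set_cat F"
    and jointly: "\<And>X Y P p q a b. \<lbrakk>is_product C X Y P p q; a \<in> fobj F P; b \<in> fobj F P;
         (fmap F P X p a, fmap F P X p b) \<in> \<theta> X; (fmap F P Y q a, fmap F P Y q b) \<in> \<theta> Y\<rbrakk>
         \<Longrightarrow> (a, b) \<in> \<theta> P"
  shows "preserves_finite_products C set_cat quot"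
  unfolding preserves_finite_products_def
proof (intro conjI allI impI)
  fix T assume "is_terminal C T"
  then have "is_terminal set_cat (fobj F T)"
    using pres by (simp add: preserves_finite_products_def)
  then show "is_terminal set_cat (fobj quot T)"
    by (auto simp: is_terminal_set_cat_iff quot_def)
next
  fix X Y P p q assume pr: "is_product C X Y P p q"
  then have o: "X \<in> Obj C" "Y \<in> Obj C" "P \<in> Obj C" and m: "p \<in> Hom C P X" "q \<in> Hom C P Y"
    by (auto simp: is_product_def)
  have "is_product set_cat (fobj F X) (fobj F Y) (fobj F P) (fmap F P X p) (fmap F P Y q)"
    using pr pres by (simp add: preserves_finite_products_def)
  then have F: "\<forall>a\<in>fobj F X. \<forall>b\<in>fobj F Y. \<exists>!c. c \<in> fobj F P \<and> fmap F P X p c = a \<and> fmap F P Y q c = b"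
    by (simp add: is_product_set_cat_iff)
  note mem = fmap_set_cat_mem[OF is_functor o(3,1) m(1)] fmap_set_cat_mem[OF is_functor o(3,2) m(2)]
  have "\<exists>!c. c \<in> fobj quot P \<and> fmap quot P X p c = a \<and> fmap quot P Y q c = b"
    if ab: "a \<in> fobj quot X" "b \<in> fobj quot Y" for a b
  proof -
    obtain a' b' where a': "a = rep X a'" "a' \<in> fobj F X" and b': "b = rep Y b'" "b' \<in> fobj F Y"
      using ab by (auto simp: quot_def)
    obtain c where c: "c \<in> fobj F P" "fmap F P X p c = a'" "fmap F P Y q c = b'"
      using F a' b' by blast
    show ?thesis
    proof (rule ex1I[of _ "rep P c"])
      show "rep P c \<in> fobj quot P \<and> fmap quot P X p (rep P c) = a \<and> fmap quot P Y q (rep P c) = b"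
        using c o m a' b' by (simp add: fmap_quot) (simp add: quot_def)
      fix d assume d: "d \<in> fobj quot P \<and> fmap quot P X p d = a \<and> fmap quot P Y q d = b"
      then obtain e where e: "d = rep P e" "e \<in> fobj F P" by (auto simp: quot_def)
      have "rep X (fmap F P X p e) = rep X (fmap F P X p c)"
        "rep Y (fmap F P Y q e) = rep Y (fmap F P Y q c)"
        using d e o m a' b' c by (auto simp: fmap_quot)
      then have "(e, c) \<in> \<theta> P"
        using c e o mem by (intro jointly[OF pr]) (auto simp: rep_eq_iff)
      then show "d = rep P c"
        using rep_eq_iff e c o by simp
    qed
  qed
  then show "is_product set_cat (fobj quot X) (fobj quot Y) (fobj quot P) (fmap quot P X p) (fmap quot P Y q)"
    using fmap_set_cat[OF is_functor_quot o(3,1) m(1)] fmap_set_cat[OF is_functor_quot o(3,2) m(2)]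
    by (simp add: is_product_set_cat_iff)
qed

end

definition joint_kernel ::
  "('o, 'm, 'a set, 'a \<Rightarrow> 'a) fnctr \<Rightarrow> (('o, 'm, 'a set, 'a \<Rightarrow> 'a) fnctr \<times> ('o \<Rightarrow> 'a \<Rightarrow> 'a)) set \<Rightarrow>
   'o \<Rightarrow> ('a \<times> 'a) set" where
  "joint_kernel F K X =
     {(a, b). a \<in> fobj F X \<and> b \<in> fobj F X \<and> (\<forall>S \<eta>. (S, \<eta>) \<in> K \<longrightarrow> \<eta> X a = \<eta> X b)}"

lemma functor_congruence_joint_kernel:
  assumes F: "is_functor C set_cat F"
    and K: "\<And>S \<eta>. (S, \<eta>) \<in> K \<Longrightarrow> \<eta> \<in> nat_trans C set_cat F S"
  shows "functor_congruence C F (joint_kernel F K)"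
proof
  show "equiv (fobj F X) (joint_kernel F K X)" if "X \<in> Obj C" for X
  proof (rule equivI)
    show "sym (joint_kernel F K X)"
      unfolding joint_kernel_def by (rule symI) (clarsimp, metis)
    show "refl_on (fobj F X) (joint_kernel F K X)"
      "joint_kernel F K X \<subseteq> fobj F X \<times> fobj F X"
      by (auto simp: joint_kernel_def refl_on_def)
    show "trans (joint_kernel F K X)"
    proof (rule transI)
      fix a b c assume "(a, b) \<in> joint_kernel F K X" "(b, c) \<in> joint_kernel F K X"
      then show "(a, c) \<in> joint_kernel F K X"
        unfolding joint_kernel_def by (clarsimp, metis)
    qed
  qed
  show "(fmap F X Y f a, fmap F X Y f b) \<in> joint_kernel F K Y"
    if o: "X \<in> Obj C" "Y \<in> Obj C" "f \<in> Hom C X Y" and ab: "(a, b) \<in> joint_kernel F K X" for X Y f a b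
  proof -
    have mem: "a \<in> fobj F X" "b \<in> fobj F X" and eq: "\<And>S \<eta>. (S, \<eta>) \<in> K \<Longrightarrow> \<eta> X a = \<eta> X b"
      using ab by (auto simp: joint_kernel_def)
    have "\<eta> Y (fmap F X Y f a) = \<eta> Y (fmap F X Y f b)" if k: "(S, \<eta>) \<in> K" for S \<eta>
      using nat_trans_natural[OF K[OF k] o] mem eq[OF k] by simp
    then show ?thesis
      using fmap_set_cat_mem[OF F o] mem by (simp add: joint_kernel_def)
  qed
qed (rule F)

text \<open>A product-preserving target \<open>S\<close> detects elements of \<open>S P\<close> by their two components, so two elements
  of \<open>F P\<close> whose components are identified by every \<open>\<eta>\<close> are themselves identified by every \<open>\<eta>\<close>.\<close>

lemma joint_kernel_product:
  assumes F: "is_functor C set_cat F"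
    and K: "\<And>S \<eta>. (S, \<eta>) \<in> K \<Longrightarrow> \<eta> \<in> nat_trans C set_cat F S \<and> is_functor C set_cat S \<and>
        preserves_finite_products C set_cat S"
    and pr: "is_product C X Y P p q" and ab: "a \<in> fobj F P" "b \<in> fobj F P"
    and p: "(fmap F P X p a, fmap F P X p b) \<in> joint_kernel F K X"
    and q: "(fmap F P Y q a, fmap F P Y q b) \<in> joint_kernel F K Y"
  shows "(a, b) \<in> joint_kernel F K P"
proof -
  have o: "X \<in> Obj C" "Y \<in> Obj C" "P \<in> Obj C" and m: "p \<in> Hom C P X" "q \<in> Hom C P Y"
    using pr by (auto simp: is_product_def)
  have "\<eta> P a = \<eta> P b" if k: "(S, \<eta>) \<in> K" for S \<eta>
  proof -
    have S: "is_functor C set_cat S" and \<eta>: "\<eta> \<in> nat_trans C set_cat F S"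
      and "is_product set_cat (fobj S X) (fobj S Y) (fobj S P) (fmap S P X p) (fmap S P Y q)"
      using K[OF k] pr by (auto simp: preserves_finite_products_def)
    then have un: "\<exists>!c. c \<in> fobj S P \<and> fmap S P X p c = x \<and> fmap S P Y q c = y"
      if "x \<in> fobj S X" "y \<in> fobj S Y" for x y
      using that by (simp add: is_product_set_cat_iff)
    have "fmap S P X p (\<eta> P a) = fmap S P X p (\<eta> P b)" "fmap S P Y q (\<eta> P a) = fmap S P Y q (\<eta> P b)"
      using p q k ab o m by (auto simp: joint_kernel_def nat_trans_natural[OF \<eta>, symmetric])
    moreover have "\<eta> P a \<in> fobj S P" "\<eta> P b \<in> fobj S P"
      using ab o by (auto intro: nat_trans_mem[OF \<eta>])
    ultimately show ?thesis
      using un fmap_set_cat_mem[OF S o(3,1) m(1)] fmap_set_cat_mem[OF S o(3,2) m(2)] by metis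
  qed
  with ab show ?thesis by (auto simp: joint_kernel_def)
qed

section \<open>Finite G-sets\<close>

lemma act_mem:
  "fin_gset G X \<Longrightarrow> g \<in> carrier G \<Longrightarrow> x \<in> pts X \<Longrightarrow> act X g x \<in> pts X"
  by (auto simp: fin_gset_def intro: group_action.element_image)

lemma fin_gsetI:
  assumes G: "group G" and fin: "finite (pts X)"
    and mem: "\<And>g x. g \<in> carrier G \<Longrightarrow> x \<in> pts X \<Longrightarrow> act X g x \<in> pts X"
    and ext: "\<And>g. g \<in> carrier G \<Longrightarrow> act X g \<in> extensional (pts X)"
    and one: "\<And>x. x \<in> pts X \<Longrightarrow> act X \<one>\<^bsub>G\<^esub> x = x"
    and mult: "\<And>g h x. g \<in> carrier G \<Longrightarrow> h \<in> carrier G \<Longrightarrow> x \<in> pts X \<Longrightarrow>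
       act X (g \<otimes>\<^bsub>G\<^esub> h) x = act X g (act X h x)"
  shows "fin_gset G X"
proof -
  interpret group G by (rule G)
  have bij: "act X g \<in> Bij (pts X)" if g: "g \<in> carrier G" for g
  proof -
    have "bij_betw (act X g) (pts X) (pts X)"
      using mem g mult[of "inv\<^bsub>G\<^esub> g" g] mult[of g "inv\<^bsub>G\<^esub> g"] one
      by (intro bij_betwI[where g = "act X (inv\<^bsub>G\<^esub> g)"]) auto
    then show ?thesis using ext[OF g] by (simp add: Bij_def)
  qed
  have "group_hom G (BijGroup (pts X)) (act X)"
  proof (intro group_hom.intro group_hom_axioms.intro homI)
    show "act X (g \<otimes>\<^bsub>G\<^esub> h) = act X g \<otimes>\<^bsub>BijGroup (pts X)\<^esub> act X h"
      if "g \<in> carrier G" "h \<in> carrier G" for g h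
    proof (rule extensionalityI[of _ "pts X"])
      show "act X g \<otimes>\<^bsub>BijGroup (pts X)\<^esub> act X h \<in> extensional (pts X)"
        using bij that by (simp add: BijGroup_def)
    qed (use that bij mult ext in \<open>auto simp: BijGroup_def compose_def\<close>)
  qed (use bij in \<open>auto simp: BijGroup_def group_BijGroup[unfolded BijGroup_def] G\<close>)
  then show ?thesis
    using fin by (simp add: fin_gset_def group_action_def)
qed

lemma fin_gset_group: "fin_gset G X \<Longrightarrow> group G"
  by (simp add: fin_gset_def group_action_def group_hom_def)

lemma act_one: "fin_gset G X \<Longrightarrow> x \<in> pts X \<Longrightarrow> act X \<one>\<^bsub>G\<^esub> x = x"
  unfolding fin_gset_def using group_action.id_eq_one[of G "pts X" "act X"] by (metis restrict_apply')

lemma act_mult: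
  "fin_gset G X \<Longrightarrow> g \<in> carrier G \<Longrightarrow> h \<in> carrier G \<Longrightarrow> x \<in> pts X \<Longrightarrow>
     act X (g \<otimes>\<^bsub>G\<^esub> h) x = act X g (act X h x)"
  unfolding fin_gset_def using group_action.composition_rule[of G "pts X" "act X"] by simp

lemma fin_gset_empty: "group G \<Longrightarrow> fin_gset G empty_gset"
  by (rule fin_gsetI) (auto simp: empty_gset_def)

lemma pts_empty [simp]: "pts empty_gset = {}"
  by (simp add: empty_gset_def)

lemma fin_gset_free_orbit:
  assumes "group G" "finite (carrier G)"
  shows "fin_gset G (free_orbit G)"
proof -
  interpret group G by (rule assms)
  show ?thesis
    using assms by (intro fin_gsetI) (auto simp: free_orbit_def m_assoc)
qed

lemma gmap_mem: "gmap G X Y f \<Longrightarrow> x \<in> pts X \<Longrightarrow> f x \<in> pts Y"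
  by (auto simp: gmap_def)

lemma gmap_act: "gmap G X Y f \<Longrightarrow> g \<in> carrier G \<Longrightarrow> x \<in> pts X \<Longrightarrow> f (act X g x) = act Y g (f x)"
  by (auto simp: gmap_def)

lemma gmap_id: "gmap G X X (\<lambda>x. x)"
  by (auto simp: gmap_def)

lemma gmap_comp: "gmap G X Y f \<Longrightarrow> gmap G Y Z h \<Longrightarrow> gmap G X Z (h \<circ> f)"
  by (auto simp: gmap_def Pi_iff)

lemma gmap_from_empty: "gmap G empty_gset Y f"
  by (simp add: gmap_def)

text \<open>A map that factors through an injective equivariant map factors equivariantly. The last two
  conclusions make this also the source of inverses (for \<open>h\<close> the identity) and of isomorphisms between
  two injections with the same image.\<close>

lemma gmap_factor:
  assumes X: "fin_gset G X" and Z: "fin_gset G Z" and f: "gmap G X Y f" "inj_on f (pts X)"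
    and h: "gmap G Z Y h" "h ` pts Z \<subseteq> f ` pts X"
  obtains k where "gmap G Z X k" "\<And>z. z \<in> pts Z \<Longrightarrow> f (k z) = h z"
    "inj_on h (pts Z) \<Longrightarrow> inj_on k (pts Z)"
    "f ` pts X \<subseteq> h ` pts Z \<Longrightarrow> k ` pts Z = pts X"
proof -
  define k where "k = (\<lambda>z. inv_into (pts X) f (h z))"
  have k: "k z \<in> pts X" "f (k z) = h z" if "z \<in> pts Z" for z
  proof -
    have "h z \<in> f ` pts X" using h(2) that by blast
    then show "k z \<in> pts X" "f (k z) = h z"
      unfolding k_def by (simp_all add: inv_into_into f_inv_into_f)
  qed
  have gm: "gmap G Z X k"
    unfolding gmap_def
  proof (intro conjI ballI)
    fix g z assume g: "g \<in> carrier G" and z: "z \<in> pts Z"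
    have "f (k (act Z g z)) = f (act X g (k z))"
      using k act_mem[OF Z g] z gmap_act[OF h(1) g z] gmap_act[OF f(1) g] by simp
    then show "k (act Z g z) = act X g (k z)"
      using k act_mem[OF Z g] act_mem[OF X g] z by - (rule inj_onD[OF f(2)], auto)
  qed (use k in auto)
  have inj: "inj_on k (pts Z)" if "inj_on h (pts Z)"
  proof (rule inj_onI)
    fix z z' assume z: "z \<in> pts Z" "z' \<in> pts Z" "k z = k z'"
    then have "h z = h z'" using k(2)[of z] k(2)[of z'] by simp
    then show "z = z'" using inj_onD[OF that] z by blast
  qed
  have sur: "k ` pts Z = pts X" if hs: "f ` pts X \<subseteq> h ` pts Z"
  proof (intro equalityI subsetI)
    fix x assume x: "x \<in> pts X"
    then obtain z where z: "z \<in> pts Z" "f x = h z" using hs by blast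
    then have "k z = x"
      using k[OF z(1)] x z(2) by - (rule inj_onD[OF f(2)], auto)
    then show "x \<in> k ` pts Z" using z by blast
  qed (use k in auto)
  show thesis
    by (rule that[OF gm k(2) inj sur])
qed

lemma fold_map_in [simp]: "fold_map (in_left x) = x" "fold_map (in_right x) = x"
  by (simp_all add: fold_map_def in_left_def in_right_def)

lemma inj_in_left: "inj_on in_left A" and inj_in_right: "inj_on in_right A"
  by (rule inj_on_inverseI[of _ fold_map], simp)+

lemma in_left_neq_in_right [simp]: "in_left x \<noteq> in_right y" "in_right y \<noteq> in_left x"
proof -
  show "in_left x \<noteq> in_right y"
    unfolding in_left_def in_right_def prod_eq_iff by simp presburger
  then show "in_right y \<noteq> in_left x" by metis
qed

text \<open>The map out of \<open>disj_union X Y\<close> with components \<open>f\<close> and \<open>h\<close>; points of \<open>X\<close> are those with even tag.\<close>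

definition copair ::
  "('g \<times> nat \<Rightarrow> 'g \<times> nat) \<Rightarrow> ('g \<times> nat \<Rightarrow> 'g \<times> nat) \<Rightarrow> 'g \<times> nat \<Rightarrow> 'g \<times> nat" where
  "copair f h z = (if even (snd z) then f (fold_map z) else h (fold_map z))"

lemma copair_in [simp]: "copair f h (in_left x) = f x" "copair f h (in_right x) = h x"
  by (simp_all add: copair_def) (simp_all add: in_left_def in_right_def)

lemma pts_disj_union: "pts (disj_union X Y) = in_left ` pts X \<union> in_right ` pts Y"
  by (simp add: disj_union_def)

lemma act_disj_union [simp]:
  "x \<in> pts X \<Longrightarrow> act (disj_union X Y) g (in_left x) = in_left (act X g x)"
  "y \<in> pts Y \<Longrightarrow> act (disj_union X Y) g (in_right y) = in_right (act Y g y)"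
  by (simp_all add: disj_union_def) (simp_all add: in_left_def in_right_def)

lemma fin_gset_disj_union:
  assumes X: "fin_gset G X" and Y: "fin_gset G Y"
  shows "fin_gset G (disj_union X Y)"
proof (rule fin_gsetI)
  show "group G" by (rule fin_gset_group[OF X])
  show "finite (pts (disj_union X Y))"
    using X Y by (simp add: pts_disj_union fin_gset_def)
  show "act (disj_union X Y) g \<in> extensional (pts (disj_union X Y))" for g
    by (simp add: disj_union_def)
qed (auto simp: pts_disj_union act_mem[OF X] act_mem[OF Y] act_one[OF X] act_one[OF Y]
       act_mult[OF X] act_mult[OF Y])

lemma gmap_in_left: "gmap G X (disj_union X Y) in_left"
  and gmap_in_right: "gmap G Y (disj_union X Y) in_right"
  by (auto simp: gmap_def pts_disj_union)

lemma gmap_copair: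
  "gmap G X Z f \<Longrightarrow> gmap G Y Z h \<Longrightarrow> gmap G (disj_union X Y) Z (copair f h)"
  by (auto simp: gmap_def pts_disj_union)

lemma gmap_fold_map: "gmap G (disj_union X X) X fold_map"
  by (auto simp: gmap_def pts_disj_union)

lemma bij_betw_copair:
  assumes "inj_on f A" "inj_on h B" "f ` A \<inter> h ` B = {}" "f ` A \<union> h ` B = C"
  shows "bij_betw (copair f h) (in_left ` A \<union> in_right ` B) C"
proof -
  have ne: "f a \<noteq> h b" if "a \<in> A" "b \<in> B" for a b
    using assms(3) that by blast
  have "inj_on (copair f h) (in_left ` A \<union> in_right ` B)"
  proof (rule inj_onI)
    fix z w assume "z \<in> in_left ` A \<union> in_right ` B" "w \<in> in_left ` A \<union> in_right ` B"
      "copair f h z = copair f h w"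
    then show "z = w"
      by (elim UnE imageE) (simp_all add: inj_on_eq_iff[OF assms(1)] inj_on_eq_iff[OF assms(2)]
          ne ne[symmetric])
  qed
  moreover have "copair f h ` (in_left ` A \<union> in_right ` B) = C"
    using assms(4) by (simp add: image_Un image_image)
  ultimately show ?thesis by (simp add: bij_betw_def)
qed

section \<open>Isomorphism classes of bispans\<close>

lemma bispan_isoE:
  assumes "bispan_iso G S S'"
  obtains \<alpha> \<beta> where "gmap G (bA S) (bA S') \<alpha>" "bij_betw \<alpha> (pts (bA S)) (pts (bA S'))"
    "gmap G (bB S) (bB S') \<beta>" "bij_betw \<beta> (pts (bB S)) (pts (bB S'))"
    "\<And>a. a \<in> pts (bA S) \<Longrightarrow> bres S' (\<alpha> a) = bres S a"
    "\<And>a. a \<in> pts (bA S) \<Longrightarrow> bnrm S' (\<alpha> a) = \<beta> (bnrm S a)"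
    "\<And>b. b \<in> pts (bB S) \<Longrightarrow> btrf S' (\<beta> b) = btrf S b"
  using assms unfolding bispan_iso_def by (elim exE conjE) (rule that; (assumption | blast))

lemma bispan_isoI:
  assumes "gmap G (bA S) (bA S') \<alpha>" "bij_betw \<alpha> (pts (bA S)) (pts (bA S'))"
    "gmap G (bB S) (bB S') \<beta>" "bij_betw \<beta> (pts (bB S)) (pts (bB S'))"
    "\<And>a. a \<in> pts (bA S) \<Longrightarrow> bres S' (\<alpha> a) = bres S a"
    "\<And>a. a \<in> pts (bA S) \<Longrightarrow> bnrm S' (\<alpha> a) = \<beta> (bnrm S a)"
    "\<And>b. b \<in> pts (bB S) \<Longrightarrow> btrf S' (\<beta> b) = btrf S b"
  shows "bispan_iso G S S'"
  unfolding bispan_iso_def by (intro exI[of _ \<alpha>] exI[of _ \<beta>] conjI ballI assms)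

lemma bispan_iso_refl: "bispan_iso G S S"
  unfolding bispan_iso_def by (intro exI[of _ "\<lambda>x. x"]) (auto intro: gmap_id simp: bij_betw_def)

lemma bispan_iso_trans:
  assumes "bispan_iso G S S'" "bispan_iso G S' S''"
  shows "bispan_iso G S S''"
proof -
  obtain \<alpha> \<beta> where 1: "gmap G (bA S) (bA S') \<alpha>" "bij_betw \<alpha> (pts (bA S)) (pts (bA S'))"
    "gmap G (bB S) (bB S') \<beta>" "bij_betw \<beta> (pts (bB S)) (pts (bB S'))"
    "\<And>a. a \<in> pts (bA S) \<Longrightarrow> bres S' (\<alpha> a) = bres S a"
    "\<And>a. a \<in> pts (bA S) \<Longrightarrow> bnrm S' (\<alpha> a) = \<beta> (bnrm S a)"
    "\<And>b. b \<in> pts (bB S) \<Longrightarrow> btrf S' (\<beta> b) = btrf S b"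
    by (rule bispan_isoE[OF assms(1)]) (rule that; (assumption | blast))
  obtain \<alpha>' \<beta>' where 2: "gmap G (bA S') (bA S'') \<alpha>'" "bij_betw \<alpha>' (pts (bA S')) (pts (bA S''))"
    "gmap G (bB S') (bB S'') \<beta>'" "bij_betw \<beta>' (pts (bB S')) (pts (bB S''))"
    "\<And>a. a \<in> pts (bA S') \<Longrightarrow> bres S'' (\<alpha>' a) = bres S' a"
    "\<And>a. a \<in> pts (bA S') \<Longrightarrow> bnrm S'' (\<alpha>' a) = \<beta>' (bnrm S' a)"
    "\<And>b. b \<in> pts (bB S') \<Longrightarrow> btrf S'' (\<beta>' b) = btrf S' b"
    by (rule bispan_isoE[OF assms(2)]) (rule that; (assumption | blast))
  show ?thesis
  proof (rule bispan_isoI)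
    show "gmap G (bA S) (bA S'') (\<alpha>' \<circ> \<alpha>)" "gmap G (bB S) (bB S'') (\<beta>' \<circ> \<beta>)"
      by (rule gmap_comp[OF 1(1) 2(1)], rule gmap_comp[OF 1(3) 2(3)])
    show "bij_betw (\<alpha>' \<circ> \<alpha>) (pts (bA S)) (pts (bA S''))" "bij_betw (\<beta>' \<circ> \<beta>) (pts (bB S)) (pts (bB S''))"
      by (rule bij_betw_trans[OF 1(2) 2(2)], rule bij_betw_trans[OF 1(4) 2(4)])
  qed (use 1(5-7) 2(5-7) gmap_mem[OF 1(1)] gmap_mem[OF 1(3)] in auto)
qed

lemma bispan_iso_sym:
  assumes S: "is_bispan G X Y S" and S': "is_bispan G X' Y' S'" and iso: "bispan_iso G S S'"
  shows "bispan_iso G S' S"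
proof -
  have fin: "fin_gset G (bA S)" "fin_gset G (bB S)" "fin_gset G (bA S')" "fin_gset G (bB S')"
    and nrm: "gmap G (bA S) (bB S) (bnrm S)" "gmap G (bA S') (bB S') (bnrm S')"
    using S S' by (auto simp: is_bispan_def)
  obtain \<alpha> \<beta> where 1: "gmap G (bA S) (bA S') \<alpha>" "bij_betw \<alpha> (pts (bA S)) (pts (bA S'))"
    "gmap G (bB S) (bB S') \<beta>" "bij_betw \<beta> (pts (bB S)) (pts (bB S'))"
    "\<And>a. a \<in> pts (bA S) \<Longrightarrow> bres S' (\<alpha> a) = bres S a"
    "\<And>a. a \<in> pts (bA S) \<Longrightarrow> bnrm S' (\<alpha> a) = \<beta> (bnrm S a)"
    "\<And>b. b \<in> pts (bB S) \<Longrightarrow> btrf S' (\<beta> b) = btrf S b"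
    by (rule bispan_isoE[OF iso]) (rule that; (assumption | blast))
  obtain \<alpha>' where \<alpha>': "gmap G (bA S') (bA S) \<alpha>'" "\<And>a. a \<in> pts (bA S') \<Longrightarrow> \<alpha> (\<alpha>' a) = a"
      "inj_on \<alpha>' (pts (bA S'))" "\<alpha>' ` pts (bA S') = pts (bA S)"
    by (rule gmap_factor[OF fin(1,3) 1(1) _ gmap_id]) (use 1(2) in \<open>auto simp: bij_betw_def\<close>)
  obtain \<beta>' where \<beta>': "gmap G (bB S') (bB S) \<beta>'" "\<And>a. a \<in> pts (bB S') \<Longrightarrow> \<beta> (\<beta>' a) = a"
      "inj_on \<beta>' (pts (bB S'))" "\<beta>' ` pts (bB S') = pts (bB S)"
    by (rule gmap_factor[OF fin(2,4) 1(3) _ gmap_id]) (use 1(4) in \<open>auto simp: bij_betw_def\<close>)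
  have "bnrm S (\<alpha>' a) = \<beta>' (bnrm S' a)" if a: "a \<in> pts (bA S')" for a
  proof (rule inj_onD[of \<beta> "pts (bB S)"])
    have "\<beta> (bnrm S (\<alpha>' a)) = bnrm S' (\<alpha> (\<alpha>' a))"
      using 1(6) gmap_mem[OF \<alpha>'(1) a] by simp
    then show "\<beta> (bnrm S (\<alpha>' a)) = \<beta> (\<beta>' (bnrm S' a))"
      using \<alpha>'(2)[OF a] \<beta>'(2) gmap_mem[OF nrm(2) a] by simp
  qed (use 1(4) a gmap_mem[OF \<alpha>'(1)] gmap_mem[OF nrm(1)] gmap_mem[OF \<beta>'(1)] gmap_mem[OF nrm(2)]
        in \<open>auto simp: bij_betw_def\<close>)
  moreover have "bres S (\<alpha>' a) = bres S' a" if a: "a \<in> pts (bA S')" for a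
    using 1(5)[OF gmap_mem[OF \<alpha>'(1) a]] \<alpha>'(2)[OF a] by simp
  moreover have "btrf S (\<beta>' b) = btrf S' b" if b: "b \<in> pts (bB S')" for b
    using 1(7)[OF gmap_mem[OF \<beta>'(1) b]] \<beta>'(2)[OF b] by simp
  ultimately show ?thesis
    using \<alpha>' \<beta>' by (intro bispan_isoI[of G S' S \<alpha>' \<beta>']) (auto simp: bij_betw_def)
qed

lemma bispan_class_eq_iff:
  assumes "is_bispan G X Y S" "is_bispan G X Y S'"
  shows "bispan_class G X Y S = bispan_class G X Y S' \<longleftrightarrow> bispan_iso G S S'"
proof
  assume "bispan_class G X Y S = bispan_class G X Y S'"
  moreover have "S' \<in> bispan_class G X Y S'"
    using assms by (simp add: bispan_class_def bispan_iso_refl)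
  ultimately show "bispan_iso G S S'"
    by (auto simp: bispan_class_def)
next
  assume iso: "bispan_iso G S S'"
  then show "bispan_class G X Y S = bispan_class G X Y S'"
    using bispan_iso_sym[OF assms iso] bispan_iso_trans unfolding bispan_class_def by blast
qed

section \<open>Restriction of bispans along injections\<close>

text \<open>\<open>U\<close> is the part of \<open>S : Z \<leftarrow> A \<rightarrow> B \<rightarrow> W\<close> that lies over the image of the injection \<open>i : X \<rightarrow> W\<close>: the
  inclusions \<open>\<alpha>\<close> and \<open>\<beta>\<close> identify the middle objects of \<open>U\<close> with preimages in \<open>A\<close> and \<open>B\<close>. Asking for
  such inclusions, instead of constructing the preimages, makes the notion invariant under isomorphism
  of \<open>S\<close> and of \<open>U\<close>. By the next three lemmas the restrictions of the members of a
  class, if there are any, form a single class.\<close>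

definition restricts_to ::
  "('g, 'm) monoid_scheme \<Rightarrow> 'g gset \<Rightarrow> ('g \<times> nat \<Rightarrow> 'g \<times> nat) \<Rightarrow> 'g bispan \<Rightarrow> 'g bispan \<Rightarrow> bool" where
  "restricts_to G X i S U \<longleftrightarrow>
     (\<exists>\<alpha> \<beta>. gmap G (bA U) (bA S) \<alpha> \<and> inj_on \<alpha> (pts (bA U)) \<and>
            gmap G (bB U) (bB S) \<beta> \<and> inj_on \<beta> (pts (bB U)) \<and>
            \<beta> ` pts (bB U) = {b \<in> pts (bB S). btrf S b \<in> i ` pts X} \<and>
            \<alpha> ` pts (bA U) = {a \<in> pts (bA S). bnrm S a \<in> \<beta> ` pts (bB U)} \<and>
            (\<forall>a\<in>pts (bA U). bres S (\<alpha> a) = bres U a \<and> bnrm S (\<alpha> a) = \<beta> (bnrm U a)) \<and>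
            (\<forall>b\<in>pts (bB U). btrf S (\<beta> b) = i (btrf U b)))"

lemma restricts_toE:
  assumes "restricts_to G X i S U"
  obtains \<alpha> \<beta> where "gmap G (bA U) (bA S) \<alpha>" "inj_on \<alpha> (pts (bA U))"
    "gmap G (bB U) (bB S) \<beta>" "inj_on \<beta> (pts (bB U))"
    "\<beta> ` pts (bB U) = {b \<in> pts (bB S). btrf S b \<in> i ` pts X}"
    "\<alpha> ` pts (bA U) = {a \<in> pts (bA S). bnrm S a \<in> \<beta> ` pts (bB U)}"
    "\<And>a. a \<in> pts (bA U) \<Longrightarrow> bres S (\<alpha> a) = bres U a"
    "\<And>a. a \<in> pts (bA U) \<Longrightarrow> bnrm S (\<alpha> a) = \<beta> (bnrm U a)"
    "\<And>b. b \<in> pts (bB U) \<Longrightarrow> btrf S (\<beta> b) = i (btrf U b)"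
  using assms unfolding restricts_to_def by (elim exE conjE) (rule that; (assumption | blast))

lemma restricts_toI:
  assumes "gmap G (bA U) (bA S) \<alpha>" "inj_on \<alpha> (pts (bA U))"
    "gmap G (bB U) (bB S) \<beta>" "inj_on \<beta> (pts (bB U))"
    "\<beta> ` pts (bB U) = {b \<in> pts (bB S). btrf S b \<in> i ` pts X}"
    "\<alpha> ` pts (bA U) = {a \<in> pts (bA S). bnrm S a \<in> \<beta> ` pts (bB U)}"
    "\<And>a. a \<in> pts (bA U) \<Longrightarrow> bres S (\<alpha> a) = bres U a"
    "\<And>a. a \<in> pts (bA U) \<Longrightarrow> bnrm S (\<alpha> a) = \<beta> (bnrm U a)"
    "\<And>b. b \<in> pts (bB U) \<Longrightarrow> btrf S (\<beta> b) = i (btrf U b)"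
  shows "restricts_to G X i S U"
  unfolding restricts_to_def by (intro exI[of _ \<alpha>] exI[of _ \<beta>] conjI ballI assms)

lemma restricts_to_cong:
  assumes S: "is_bispan G Z W S" and iso: "bispan_iso G S S'" and U: "restricts_to G X i S U"
  shows "restricts_to G X i S' U"
proof -
  have nrm: "gmap G (bA S) (bB S) (bnrm S)" using S by (simp add: is_bispan_def)
  obtain a b where 1: "gmap G (bA S) (bA S') a" "bij_betw a (pts (bA S)) (pts (bA S'))"
    "gmap G (bB S) (bB S') b" "bij_betw b (pts (bB S)) (pts (bB S'))"
    "\<And>x. x \<in> pts (bA S) \<Longrightarrow> bres S' (a x) = bres S x"
    "\<And>x. x \<in> pts (bA S) \<Longrightarrow> bnrm S' (a x) = b (bnrm S x)"
    "\<And>y. y \<in> pts (bB S) \<Longrightarrow> btrf S' (b y) = btrf S y"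
    by (rule bispan_isoE[OF iso]) (rule that; (assumption | blast))
  obtain \<alpha> \<beta> where 2: "gmap G (bA U) (bA S) \<alpha>" "inj_on \<alpha> (pts (bA U))"
    "gmap G (bB U) (bB S) \<beta>" "inj_on \<beta> (pts (bB U))"
    "\<beta> ` pts (bB U) = {b \<in> pts (bB S). btrf S b \<in> i ` pts X}"
    "\<alpha> ` pts (bA U) = {a \<in> pts (bA S). bnrm S a \<in> \<beta> ` pts (bB U)}"
    "\<And>a. a \<in> pts (bA U) \<Longrightarrow> bres S (\<alpha> a) = bres U a"
    "\<And>a. a \<in> pts (bA U) \<Longrightarrow> bnrm S (\<alpha> a) = \<beta> (bnrm U a)"
    "\<And>b. b \<in> pts (bB U) \<Longrightarrow> btrf S (\<beta> b) = i (btrf U b)"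
    by (rule restricts_toE[OF U]) (rule that; (assumption | blast))
  have mA: "\<alpha> x \<in> pts (bA S)" if "x \<in> pts (bA U)" for x using gmap_mem[OF 2(1) that] .
  have mB: "\<beta> y \<in> pts (bB S)" if "y \<in> pts (bB U)" for y using gmap_mem[OF 2(3) that] .
  have surA: "pts (bA S') = a ` pts (bA S)" and surB: "pts (bB S') = b ` pts (bB S)"
    and injA: "inj_on a (pts (bA S))" and injB: "inj_on b (pts (bB S))"
    using 1(2,4) by (auto simp: bij_betw_def)
  have imB: "(b \<circ> \<beta>) ` pts (bB U) = {y \<in> pts (bB S'). btrf S' y \<in> i ` pts X}"
  proof -
    have "(b \<circ> \<beta>) ` pts (bB U) = b ` {y \<in> pts (bB S). btrf S y \<in> i ` pts X}"
      by (simp only: image_comp[symmetric] 2(5))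
    also have "\<dots> = {y \<in> b ` pts (bB S). btrf S' y \<in> i ` pts X}"
      using 1(7) by auto
    finally show ?thesis by (simp only: surB)
  qed
  have imA: "(a \<circ> \<alpha>) ` pts (bA U) = {x \<in> pts (bA S'). bnrm S' x \<in> (b \<circ> \<beta>) ` pts (bB U)}"
  proof -
    have iff: "bnrm S x \<in> \<beta> ` pts (bB U) \<longleftrightarrow> b (bnrm S x) \<in> (b \<circ> \<beta>) ` pts (bB U)"
      if "x \<in> pts (bA S)" for x
    proof -
      have "\<beta> ` pts (bB U) \<subseteq> pts (bB S)" using mB by blast
      from inj_on_image_mem_iff[OF injB gmap_mem[OF nrm that] this] show ?thesis
        by (simp only: image_comp[symmetric])
    qed
    have "(a \<circ> \<alpha>) ` pts (bA U) = a ` {x \<in> pts (bA S). bnrm S x \<in> \<beta> ` pts (bB U)}"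
      by (simp only: image_comp[symmetric] 2(6))
    also have "\<dots> = {x \<in> a ` pts (bA S). bnrm S' x \<in> (b \<circ> \<beta>) ` pts (bB U)}"
    proof (intro equalityI subsetI)
      fix y assume "y \<in> a ` {x \<in> pts (bA S). bnrm S x \<in> \<beta> ` pts (bB U)}"
      then obtain x where x: "y = a x" "x \<in> pts (bA S)" "bnrm S x \<in> \<beta> ` pts (bB U)" by blast
      then show "y \<in> {x \<in> a ` pts (bA S). bnrm S' x \<in> (b \<circ> \<beta>) ` pts (bB U)}"
        using 1(6) iff by simp
    next
      fix y assume "y \<in> {x \<in> a ` pts (bA S). bnrm S' x \<in> (b \<circ> \<beta>) ` pts (bB U)}"
      then obtain x where x: "y = a x" "x \<in> pts (bA S)" "bnrm S' y \<in> (b \<circ> \<beta>) ` pts (bB U)" by blast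
      then show "y \<in> a ` {x \<in> pts (bA S). bnrm S x \<in> \<beta> ` pts (bB U)}"
        using 1(6) iff by simp
    qed
    finally show ?thesis by (simp only: surA)
  qed
  show ?thesis
  proof (rule restricts_toI)
    show "gmap G (bA U) (bA S') (a \<circ> \<alpha>)" "gmap G (bB U) (bB S') (b \<circ> \<beta>)"
      by (rule gmap_comp[OF 2(1) 1(1)], rule gmap_comp[OF 2(3) 1(3)])
    show "inj_on (a \<circ> \<alpha>) (pts (bA U))" "inj_on (b \<circ> \<beta>) (pts (bB U))"
      using mA mB
      by (auto intro: comp_inj_on[OF 2(2) inj_on_subset[OF injA]] comp_inj_on[OF 2(4) inj_on_subset[OF injB]])
  qed (use imA imB 1(5-7) 2(7-9) mA mB in simp_all)
qed

lemma restricts_to_iso: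
  assumes U: "is_bispan G Z X U" and U': "is_bispan G Z X U'" and iso: "bispan_iso G U U'"
    and r: "restricts_to G X i S U"
  shows "restricts_to G X i S U'"
proof -
  obtain a b where 1: "gmap G (bA U') (bA U) a" "bij_betw a (pts (bA U')) (pts (bA U))"
    "gmap G (bB U') (bB U) b" "bij_betw b (pts (bB U')) (pts (bB U))"
    "\<And>x. x \<in> pts (bA U') \<Longrightarrow> bres U (a x) = bres U' x"
    "\<And>x. x \<in> pts (bA U') \<Longrightarrow> bnrm U (a x) = b (bnrm U' x)"
    "\<And>y. y \<in> pts (bB U') \<Longrightarrow> btrf U (b y) = btrf U' y"
    by (rule bispan_isoE[OF bispan_iso_sym[OF U U' iso]]) (rule that; (assumption | blast))
  obtain \<alpha> \<beta> where 2: "gmap G (bA U) (bA S) \<alpha>" "inj_on \<alpha> (pts (bA U))"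
    "gmap G (bB U) (bB S) \<beta>" "inj_on \<beta> (pts (bB U))"
    "\<beta> ` pts (bB U) = {b \<in> pts (bB S). btrf S b \<in> i ` pts X}"
    "\<alpha> ` pts (bA U) = {a \<in> pts (bA S). bnrm S a \<in> \<beta> ` pts (bB U)}"
    "\<And>a. a \<in> pts (bA U) \<Longrightarrow> bres S (\<alpha> a) = bres U a"
    "\<And>a. a \<in> pts (bA U) \<Longrightarrow> bnrm S (\<alpha> a) = \<beta> (bnrm U a)"
    "\<And>b. b \<in> pts (bB U) \<Longrightarrow> btrf S (\<beta> b) = i (btrf U b)"
    by (rule restricts_toE[OF r]) (rule that; (assumption | blast))
  have im: "(\<alpha> \<circ> a) ` pts (bA U') = \<alpha> ` pts (bA U)" "(\<beta> \<circ> b) ` pts (bB U') = \<beta> ` pts (bB U)"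
    by (simp_all only: image_comp[symmetric] bij_betw_imp_surj_on[OF 1(2)] bij_betw_imp_surj_on[OF 1(4)])
  show ?thesis
  proof (rule restricts_toI)
    show "gmap G (bA U') (bA S) (\<alpha> \<circ> a)" "gmap G (bB U') (bB S) (\<beta> \<circ> b)"
      by (rule gmap_comp[OF 1(1) 2(1)], rule gmap_comp[OF 1(3) 2(3)])
    show "inj_on (\<alpha> \<circ> a) (pts (bA U'))" "inj_on (\<beta> \<circ> b) (pts (bB U'))"
      using 1(2,4) 2(2,4) by (simp_all add: bij_betw_def comp_inj_on)
    show "(\<beta> \<circ> b) ` pts (bB U') = {b \<in> pts (bB S). btrf S b \<in> i ` pts X}"
      "(\<alpha> \<circ> a) ` pts (bA U') = {a \<in> pts (bA S). bnrm S a \<in> (\<beta> \<circ> b) ` pts (bB U')}"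
      by (simp_all only: im 2(5,6))
  qed (use 1(5-7) 2(7-9) gmap_mem[OF 1(1)] gmap_mem[OF 1(3)] in simp_all)
qed

lemma restricts_to_unique:
  assumes U: "is_bispan G Z X U" and U': "is_bispan G Z X U'" and i: "inj_on i (pts X)"
    and r: "restricts_to G X i S U" "restricts_to G X i S U'"
  shows "bispan_iso G U U'"
proof -
  have fin: "fin_gset G (bA U)" "fin_gset G (bB U)" "fin_gset G (bA U')" "fin_gset G (bB U')"
    and nrm: "gmap G (bA U) (bB U) (bnrm U)" "gmap G (bA U') (bB U') (bnrm U')"
    and trf: "gmap G (bB U) X (btrf U)" "gmap G (bB U') X (btrf U')"
    using U U' by (auto simp: is_bispan_def)
  obtain \<alpha> \<beta> where 1: "gmap G (bA U) (bA S) \<alpha>" "inj_on \<alpha> (pts (bA U))"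
    "gmap G (bB U) (bB S) \<beta>" "inj_on \<beta> (pts (bB U))"
    "\<beta> ` pts (bB U) = {b \<in> pts (bB S). btrf S b \<in> i ` pts X}"
    "\<alpha> ` pts (bA U) = {a \<in> pts (bA S). bnrm S a \<in> \<beta> ` pts (bB U)}"
    "\<And>a. a \<in> pts (bA U) \<Longrightarrow> bres S (\<alpha> a) = bres U a"
    "\<And>a. a \<in> pts (bA U) \<Longrightarrow> bnrm S (\<alpha> a) = \<beta> (bnrm U a)"
    "\<And>b. b \<in> pts (bB U) \<Longrightarrow> btrf S (\<beta> b) = i (btrf U b)"
    by (rule restricts_toE[OF r(1)]) (rule that; (assumption | blast))
  obtain \<alpha>' \<beta>' where 2: "gmap G (bA U') (bA S) \<alpha>'" "inj_on \<alpha>' (pts (bA U'))"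
    "gmap G (bB U') (bB S) \<beta>'" "inj_on \<beta>' (pts (bB U'))"
    "\<beta>' ` pts (bB U') = {b \<in> pts (bB S). btrf S b \<in> i ` pts X}"
    "\<alpha>' ` pts (bA U') = {a \<in> pts (bA S). bnrm S a \<in> \<beta>' ` pts (bB U')}"
    "\<And>a. a \<in> pts (bA U') \<Longrightarrow> bres S (\<alpha>' a) = bres U' a"
    "\<And>a. a \<in> pts (bA U') \<Longrightarrow> bnrm S (\<alpha>' a) = \<beta>' (bnrm U' a)"
    "\<And>b. b \<in> pts (bB U') \<Longrightarrow> btrf S (\<beta>' b) = i (btrf U' b)"
    by (rule restricts_toE[OF r(2)]) (rule that; (assumption | blast))
  have imB: "\<beta> ` pts (bB U) = \<beta>' ` pts (bB U')" using 1(5) 2(5) by simp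
  then have imA: "\<alpha> ` pts (bA U) = \<alpha>' ` pts (bA U')" using 1(6) 2(6) by simp
  obtain a where a: "gmap G (bA U) (bA U') a" "\<And>x. x \<in> pts (bA U) \<Longrightarrow> \<alpha>' (a x) = \<alpha> x"
      "inj_on a (pts (bA U))" "a ` pts (bA U) = pts (bA U')"
    by (rule gmap_factor[OF fin(3,1) 2(1,2) 1(1)]) (use imA 1(2) in auto)
  obtain b where b: "gmap G (bB U) (bB U') b" "\<And>x. x \<in> pts (bB U) \<Longrightarrow> \<beta>' (b x) = \<beta> x"
      "inj_on b (pts (bB U))" "b ` pts (bB U) = pts (bB U')"
    by (rule gmap_factor[OF fin(4,2) 2(3,4) 1(3)]) (use imB 1(4) in auto)
  have "bres U' (a x) = bres U x \<and> bnrm U' (a x) = b (bnrm U x)" if x: "x \<in> pts (bA U)" for x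
  proof
    have ax: "a x \<in> pts (bA U')" using gmap_mem[OF a(1) x] .
    show "bres U' (a x) = bres U x"
      using 1(7)[OF x] 2(7)[OF ax] a(2)[OF x] by simp
    have "\<beta>' (bnrm U' (a x)) = \<beta>' (b (bnrm U x))"
      using 1(8)[OF x] 2(8)[OF ax] a(2)[OF x] b(2)[OF gmap_mem[OF nrm(1) x]] by simp
    then show "bnrm U' (a x) = b (bnrm U x)"
      using gmap_mem[OF nrm(2) ax] gmap_mem[OF b(1) gmap_mem[OF nrm(1) x]] by - (rule inj_onD[OF 2(4)])
  qed
  moreover have "btrf U' (b y) = btrf U y" if y: "y \<in> pts (bB U)" for y
  proof (rule inj_onD[OF i])
    show "i (btrf U' (b y)) = i (btrf U y)"
      using 1(9)[OF y] 2(9)[OF gmap_mem[OF b(1) y]] b(2)[OF y] by simp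
  qed (use y gmap_mem[OF trf(1)] gmap_mem[OF trf(2)] gmap_mem[OF b(1)] in auto)
  ultimately show ?thesis
    using a b by (intro bispan_isoI[of G U U' a b]) (auto simp: bij_betw_def)
qed

section \<open>Composition with restrictions along injections\<close>

lemma is_pullback_comm:
  "is_pullback G P A B C p q f g \<Longrightarrow> x \<in> pts P \<Longrightarrow> f (p x) = g (q x)"
  by (auto simp: is_pullback_def dest: bij_betwE)

lemma is_pullback_inj:
  "is_pullback G P A B C p q f g \<Longrightarrow> x \<in> pts P \<Longrightarrow> y \<in> pts P \<Longrightarrow> p x = p y \<Longrightarrow> q x = q y \<Longrightarrow> x = y"
  by (auto simp: is_pullback_def bij_betw_def dest: inj_onD)

lemma is_pullback_surj:
  assumes "is_pullback G P A B C p q f g" "a \<in> pts A" "b \<in> pts B" "f a = g b"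
  obtains x where "x \<in> pts P" "p x = a" "q x = b"
proof -
  have "(a, b) \<in> (\<lambda>x. (p x, q x)) ` pts P"
    using assms by (simp add: is_pullback_def bij_betw_def)
  then show thesis using that by blast
qed

lemma is_compositeI:
  assumes "is_bispan G X Y S" "is_bispan G Y Z T" "is_bispan G X Z U"
    and "is_pullback G P (bB S) (bA T) Y p h (btrf S) (bres T)"
    and "is_exponential G P (bA T) (bB T) E (bB U) h (bnrm T) \<epsilon> \<nu> \<rho>"
    and "is_pullback G (bA U) (bA S) E (bB S) u v (bnrm S) (p \<circ> \<epsilon>)"
    and "\<And>a. a \<in> pts (bA U) \<Longrightarrow> bres U a = bres S (u a)"
    and "\<And>a. a \<in> pts (bA U) \<Longrightarrow> bnrm U a = \<nu> (v a)"
    and "\<And>n. n \<in> pts (bB U) \<Longrightarrow> btrf U n = btrf T (\<rho> n)"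
  shows "is_composite G X Y Z T S U"
  unfolding is_composite_def
  by (intro conjI assms(1-3), rule exI[of _ P], rule exI[of _ E], rule exI[of _ p], rule exI[of _ h],
      rule exI[of _ \<epsilon>], rule exI[of _ \<nu>], rule exI[of _ \<rho>], rule exI[of _ u], rule exI[of _ v])
    (simp add: assms(4-9))

text \<open>In a composite with the restriction along \<open>i\<close>, the dependent product is taken along an isomorphism.
  Hence it changes nothing: \<open>\<epsilon>\<close> and \<open>\<nu>\<close> are bijective, and the composite is obtained from \<open>S\<close> by two
  pullbacks, first along \<open>i\<close> and then along \<open>bnrm S\<close>. These are the two preimages of a restriction.\<close>

lemma restricts_to_if_composite:
  assumes comp: "is_composite G Z W X T S U"
    and T: "bispan_iso G \<lparr>bA = X, bB = X, bres = i, bnrm = (\<lambda>x. x), btrf = (\<lambda>x. x)\<rparr> T"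
    and i: "inj_on i (pts X)"
  shows "restricts_to G X i S U"
proof -
  obtain P E p h \<epsilon> \<nu> \<rho> u v where
    P: "is_pullback G P (bB S) (bA T) W p h (btrf S) (bres T)" and
    ex: "is_exponential G P (bA T) (bB T) E (bB U) h (bnrm T) \<epsilon> \<nu> \<rho>" and
    A: "is_pullback G (bA U) (bA S) E (bB S) u v (bnrm S) (p \<circ> \<epsilon>)" and
    U: "\<And>a. a \<in> pts (bA U) \<Longrightarrow> bres U a = bres S (u a)"
       "\<And>a. a \<in> pts (bA U) \<Longrightarrow> bnrm U a = \<nu> (v a)"
       "\<And>n. n \<in> pts (bB U) \<Longrightarrow> btrf U n = btrf T (\<rho> n)"
    using comp unfolding is_composite_def by (elim exE conjE) blast
  have E: "is_pullback G E (bA T) (bB U) (bB T) (h \<circ> \<epsilon>) \<nu> (bnrm T) \<rho>" and \<epsilon>: "gmap G E P \<epsilon>"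
    using ex by (auto simp: is_exponential_def)
  have sec: "\<exists>!n. n \<in> pts (bB U) \<and> \<rho> n = b \<and> (\<forall>e\<in>pts E. \<nu> e = n \<longrightarrow> \<epsilon> e = s (h (\<epsilon> e)))"
    if "b \<in> pts (bB T)" "\<And>a. a \<in> pts (bA T) \<Longrightarrow> bnrm T a = b \<Longrightarrow> s a \<in> pts P \<and> h (s a) = a" for b s
    using ex that by (simp add: is_exponential_def)
  have p: "gmap G P (bB S) p" and h: "gmap G P (bA T) h" and \<nu>: "gmap G E (bB U) \<nu>"
    and \<rho>: "gmap G (bB U) (bB T) \<rho>" and u: "gmap G (bA U) (bA S) u" and v: "gmap G (bA U) E v"
    and finE: "fin_gset G E" and finN: "fin_gset G (bB U)"
    using P E A by (auto simp: is_pullback_def)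
  have nT: "gmap G (bA T) (bB T) (bnrm T)"
    using comp by (auto simp: is_composite_def is_bispan_def)
  obtain \<gamma> \<delta> where \<gamma>: "bij_betw \<gamma> (pts X) (pts (bA T))" and \<delta>: "bij_betw \<delta> (pts X) (pts (bB T))"
    and \<gamma>T: "\<And>x. x \<in> pts X \<Longrightarrow> bres T (\<gamma> x) = i x" "\<And>x. x \<in> pts X \<Longrightarrow> bnrm T (\<gamma> x) = \<delta> x"
    and \<delta>T: "\<And>x. x \<in> pts X \<Longrightarrow> btrf T (\<delta> x) = x"
    by (rule bispan_isoE[OF T]) simp
  have \<gamma>X: "\<gamma> x \<in> pts (bA T)" if "x \<in> pts X" for x
    using \<gamma> that by (rule bij_betw_apply)
  have ofX: "\<exists>x\<in>pts X. c = \<gamma> x" if "c \<in> pts (bA T)" for c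
    using \<gamma> that by (auto simp: bij_betw_def)
  have nT_inj: "c = c'" if c: "c \<in> pts (bA T)" "c' \<in> pts (bA T)" "bnrm T c = bnrm T c'" for c c'
  proof -
    obtain x x' where x: "x \<in> pts X" "c = \<gamma> x" "x' \<in> pts X" "c' = \<gamma> x'"
      using ofX c(1,2) by metis
    then have "\<delta> x = \<delta> x'" using \<gamma>T(2) c(3) by simp
    then have "x = x'" using bij_betw_imp_inj_on[OF \<delta>] x by (simp add: inj_on_eq_iff)
    then show ?thesis using x by simp
  qed
  have nT_surj: "\<exists>c\<in>pts (bA T). bnrm T c = d" if "d \<in> pts (bB T)" for d
  proof -
    have "d \<in> \<delta> ` pts X" using bij_betw_imp_surj_on[OF \<delta>] that by simp
    then obtain x where "x \<in> pts X" "d = \<delta> x" by blast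
    then show ?thesis using \<gamma>T(2) \<gamma>X by blast
  qed
  have rT_trf: "bres T c = i (btrf T (bnrm T c))" "btrf T (bnrm T c) \<in> pts X"
    if "c \<in> pts (bA T)" for c
    using ofX[OF that] \<gamma>T \<delta>T by auto
  have rT_inj: "c = c'" if c: "c \<in> pts (bA T)" "c' \<in> pts (bA T)" "bres T c = bres T c'" for c c'
  proof -
    obtain x x' where x: "x \<in> pts X" "c = \<gamma> x" "x' \<in> pts X" "c' = \<gamma> x'"
      using ofX c(1,2) by metis
    then have "i x = i x'" using \<gamma>T(1) c(3) by simp
    then have "x = x'" using i x by (simp add: inj_on_eq_iff)
    then show ?thesis using x by simp
  qed
  \<comment> \<open>\<open>bnrm T\<close> is bijective, so its pullback \<open>\<nu>\<close> is too\<close>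
  have \<nu>\<rho>: "\<rho> (\<nu> e) = bnrm T (h (\<epsilon> e))" if "e \<in> pts E" for e
    using is_pullback_comm[OF E that] by simp
  have hE: "h (\<epsilon> e) \<in> pts (bA T)" if "e \<in> pts E" for e
    using gmap_mem[OF h gmap_mem[OF \<epsilon> that]] .
  have \<nu>_inj: "e = e'" if e: "e \<in> pts E" "e' \<in> pts E" "\<nu> e = \<nu> e'" for e e'
  proof -
    have "h (\<epsilon> e) = h (\<epsilon> e')"
      by (rule nT_inj[OF hE[OF e(1)] hE[OF e(2)]]) (simp add: e(3) \<nu>\<rho>[symmetric] e(1,2))
    then show ?thesis using is_pullback_inj[OF E e(1,2)] e(3) by simp
  qed
  have \<nu>_surj: "\<nu> ` pts E = pts (bB U)"
  proof (intro equalityI subsetI)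
    fix n assume n: "n \<in> pts (bB U)"
    obtain c where c: "c \<in> pts (bA T)" "bnrm T c = \<rho> n" using nT_surj gmap_mem[OF \<rho> n] by blast
    obtain e where "e \<in> pts E" "\<nu> e = n" by (rule is_pullback_surj[OF E c(1) n c(2)])
    then show "n \<in> \<nu> ` pts E" by blast
  qed (use gmap_mem[OF \<nu>] in blast)
  \<comment> \<open>a section of \<open>h\<close> over a one-point fibre of \<open>bnrm T\<close> is just a point of \<open>P\<close>\<close>
  have \<epsilon>_inj: "e = e'" if e: "e \<in> pts E" "e' \<in> pts E" "\<epsilon> e = \<epsilon> e'" for e e'
  proof -
    let ?P = "\<lambda>n. n \<in> pts (bB U) \<and> \<rho> n = \<rho> (\<nu> e) \<and> (\<forall>e''\<in>pts E. \<nu> e'' = n \<longrightarrow> \<epsilon> e'' = \<epsilon> e)"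
    have un: "\<exists>!n. ?P n"
    proof (rule sec[of "\<rho> (\<nu> e)" "\<lambda>_. \<epsilon> e"])
      show "\<rho> (\<nu> e) \<in> pts (bB T)" using gmap_mem[OF \<rho> gmap_mem[OF \<nu> e(1)]] .
      show "\<epsilon> e \<in> pts P \<and> h (\<epsilon> e) = a" if "a \<in> pts (bA T)" "bnrm T a = \<rho> (\<nu> e)" for a
        using gmap_mem[OF \<epsilon> e(1)] nT_inj[OF hE[OF e(1)] that(1)] that(2) \<nu>\<rho>[OF e(1)] by simp
    qed
    have 1: "?P (\<nu> e)"
      using gmap_mem[OF \<nu> e(1)] \<nu>_inj[OF _ e(1)] by blast
    have 2: "?P (\<nu> e')"
    proof (intro conjI ballI impI)
      show "\<rho> (\<nu> e') = \<rho> (\<nu> e)" using \<nu>\<rho>[OF e(1)] \<nu>\<rho>[OF e(2)] e(3) by simp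
      show "\<epsilon> e'' = \<epsilon> e" if "e'' \<in> pts E" "\<nu> e'' = \<nu> e'" for e''
        using \<nu>_inj[OF that(1) e(2) that(2)] e(3) by simp
    qed (use gmap_mem[OF \<nu> e(2)] in simp)
    have "\<nu> e = \<nu> e'"
      using trans[OF the1_equality[OF un 1, symmetric] the1_equality[OF un 2]] .
    then show ?thesis using \<nu>_inj e by blast
  qed
  have \<epsilon>_surj: "\<epsilon> ` pts E = pts P"
  proof (intro equalityI subsetI)
    fix x assume x: "x \<in> pts P"
    note hx = gmap_mem[OF h x]
    have "\<exists>!n. n \<in> pts (bB U) \<and> \<rho> n = bnrm T (h x) \<and> (\<forall>e\<in>pts E. \<nu> e = n \<longrightarrow> \<epsilon> e = x)"
      by (rule sec[of "bnrm T (h x)" "\<lambda>_. x"]) (use gmap_mem[OF nT hx] x nT_inj[OF hx] in auto)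
    then obtain n where n: "n \<in> pts (bB U)" "\<rho> n = bnrm T (h x)"
      and nx: "\<forall>e\<in>pts E. \<nu> e = n \<longrightarrow> \<epsilon> e = x" by (elim ex1E conjE)
    obtain e where "e \<in> pts E" "\<nu> e = n" by (rule is_pullback_surj[OF E hx n(1) n(2)[symmetric]])
    then show "x \<in> \<epsilon> ` pts E" using nx by blast
  qed (use gmap_mem[OF \<epsilon>] in blast)
  have p_trf: "btrf S (p x) = bres T (h x)" if "x \<in> pts P" for x
    by (rule is_pullback_comm[OF P that])
  have p_inj: "x = y" if x: "x \<in> pts P" "y \<in> pts P" "p x = p y" for x y
  proof -
    have "h x = h y"
      by (rule rT_inj[OF gmap_mem[OF h x(1)] gmap_mem[OF h x(2)]]) (simp add: x p_trf[symmetric])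
    then show ?thesis by (rule is_pullback_inj[OF P x])
  qed
  have p_im: "p ` pts P = {b \<in> pts (bB S). btrf S b \<in> i ` pts X}"
  proof (intro equalityI subsetI)
    fix b assume "b \<in> p ` pts P"
    then obtain x where x: "x \<in> pts P" "b = p x" by blast
    then show "b \<in> {b \<in> pts (bB S). btrf S b \<in> i ` pts X}"
      using gmap_mem[OF p] p_trf rT_trf[OF gmap_mem[OF h x(1)]] by simp
  next
    fix b assume "b \<in> {b \<in> pts (bB S). btrf S b \<in> i ` pts X}"
    then obtain x where b: "b \<in> pts (bB S)" and x: "x \<in> pts X" "btrf S b = i x" by blast
    have "btrf S b = bres T (\<gamma> x)" using x \<gamma>T by simp
    then obtain y where "y \<in> pts P" "p y = b" by (rule is_pullback_surj[OF P b \<gamma>X[OF x(1)]])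
    then show "b \<in> p ` pts P" by blast
  qed
  \<comment> \<open>\<open>\<kappa>\<close> inverts \<open>\<nu>\<close>, so that \<open>p \<circ> \<epsilon> \<circ> \<kappa>\<close> includes \<open>bB U\<close> into \<open>bB S\<close>\<close>
  obtain \<kappa> where \<kappa>: "gmap G (bB U) E \<kappa>" "\<And>n. n \<in> pts (bB U) \<Longrightarrow> \<nu> (\<kappa> n) = n"
      "inj_on \<kappa> (pts (bB U))" "\<kappa> ` pts (bB U) = pts E"
  proof (rule gmap_factor[OF finE finN \<nu> _ gmap_id])
    show "inj_on \<nu> (pts E)" using \<nu>_inj by (rule inj_onI)
  qed (use \<nu>_surj in auto)
  have \<kappa>\<nu>: "\<kappa> (\<nu> e) = e" if "e \<in> pts E" for e
    using \<nu>_inj \<kappa>(2) gmap_mem[OF \<kappa>(1)] gmap_mem[OF \<nu> that] that by blast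
  have im: "(p \<circ> \<epsilon> \<circ> \<kappa>) ` pts (bB U) = p ` pts P"
    by (simp only: image_comp[symmetric] \<kappa>(4) \<epsilon>_surj)
  have A_comm: "bnrm S (u a) = p (\<epsilon> (v a))" if "a \<in> pts (bA U)" for a
    using is_pullback_comm[OF A that] by simp
  show ?thesis
  proof (rule restricts_toI)
    show "gmap G (bA U) (bA S) u" by (rule u)
    show "gmap G (bB U) (bB S) (p \<circ> \<epsilon> \<circ> \<kappa>)"
      by (rule gmap_comp[OF \<kappa>(1) gmap_comp[OF \<epsilon> p]])
    show "inj_on u (pts (bA U))"
    proof (rule inj_onI)
      fix a a' assume a: "a \<in> pts (bA U)" "a' \<in> pts (bA U)" "u a = u a'"
      note va = gmap_mem[OF v a(1)] gmap_mem[OF v a(2)]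
      have "p (\<epsilon> (v a)) = p (\<epsilon> (v a'))"
        using A_comm[OF a(1)] A_comm[OF a(2)] a(3) by simp
      then have "v a = v a'"
        by (rule \<epsilon>_inj[OF va p_inj[OF gmap_mem[OF \<epsilon> va(1)] gmap_mem[OF \<epsilon> va(2)]]])
      then show "a = a'" by (rule is_pullback_inj[OF A a])
    qed
    show "inj_on (p \<circ> \<epsilon> \<circ> \<kappa>) (pts (bB U))"
    proof (rule inj_onI)
      fix n n' assume n: "n \<in> pts (bB U)" "n' \<in> pts (bB U)" "(p \<circ> \<epsilon> \<circ> \<kappa>) n = (p \<circ> \<epsilon> \<circ> \<kappa>) n'"
      note k = gmap_mem[OF \<kappa>(1) n(1)] gmap_mem[OF \<kappa>(1) n(2)]
      have "\<kappa> n = \<kappa> n'"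
        by (rule \<epsilon>_inj[OF k p_inj[OF gmap_mem[OF \<epsilon> k(1)] gmap_mem[OF \<epsilon> k(2)]]]) (use n(3) in simp)
      then show "n = n'" using inj_onD[OF \<kappa>(3)] n by blast
    qed
    show "(p \<circ> \<epsilon> \<circ> \<kappa>) ` pts (bB U) = {b \<in> pts (bB S). btrf S b \<in> i ` pts X}"
      by (simp only: im p_im)
    show "u ` pts (bA U) = {a \<in> pts (bA S). bnrm S a \<in> (p \<circ> \<epsilon> \<circ> \<kappa>) ` pts (bB U)}"
    proof (intro equalityI subsetI)
      fix a assume "a \<in> u ` pts (bA U)"
      then obtain b where b: "b \<in> pts (bA U)" "a = u b" by blast
      then show "a \<in> {a \<in> pts (bA S). bnrm S a \<in> (p \<circ> \<epsilon> \<circ> \<kappa>) ` pts (bB U)}"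
        using gmap_mem[OF u b(1)] A_comm[OF b(1)] gmap_mem[OF \<epsilon> gmap_mem[OF v b(1)]] im by simp
    next
      fix a assume "a \<in> {a \<in> pts (bA S). bnrm S a \<in> (p \<circ> \<epsilon> \<circ> \<kappa>) ` pts (bB U)}"
      then obtain n where a: "a \<in> pts (bA S)" and n: "n \<in> pts (bB U)" "bnrm S a = (p \<circ> \<epsilon>) (\<kappa> n)"
        by auto
      obtain b where "b \<in> pts (bA U)" "u b = a"
        by (rule is_pullback_surj[OF A a gmap_mem[OF \<kappa>(1) n(1)] n(2)])
      then show "a \<in> u ` pts (bA U)" by blast
    qed
    show "bres S (u a) = bres U a" if "a \<in> pts (bA U)" for a
      using U(1)[OF that] by simp
    show "bnrm S (u a) = (p \<circ> \<epsilon> \<circ> \<kappa>) (bnrm U a)" if "a \<in> pts (bA U)" for a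
      using U(2)[OF that] A_comm[OF that] \<kappa>\<nu>[OF gmap_mem[OF v that]] by simp
    show "btrf S ((p \<circ> \<epsilon> \<circ> \<kappa>) n) = i (btrf U n)" if n: "n \<in> pts (bB U)" for n
    proof -
      note k = gmap_mem[OF \<kappa>(1) n]
      have "btrf S (p (\<epsilon> (\<kappa> n))) = i (btrf T (bnrm T (h (\<epsilon> (\<kappa> n)))))"
        using p_trf[OF gmap_mem[OF \<epsilon> k]] rT_trf(1)[OF hE[OF k]] by simp
      also have "bnrm T (h (\<epsilon> (\<kappa> n))) = \<rho> n"
        using \<nu>\<rho>[OF k] \<kappa>(2)[OF n] by simp
      finally show ?thesis using U(3)[OF n] by simp
    qed
  qed
qed

text \<open>The exponential diagram along an identity may be taken to consist of identities, and the two
  pullbacks in the composite are exactly those that make \<open>U\<close> a restriction of \<open>S\<close>.\<close>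

lemma composite_if_restricts_to:
  assumes S: "is_bispan G Z W S" and U: "is_bispan G Z X U"
    and iW: "gmap G X W i" and i: "inj_on i (pts X)" and r: "restricts_to G X i S U"
  shows "is_composite G Z W X \<lparr>bA = X, bB = X, bres = i, bnrm = (\<lambda>x. x), btrf = (\<lambda>x. x)\<rparr> S U"
    (is "is_composite G Z W X ?T S U")
proof -
  have fin: "fin_gset G Z" "fin_gset G W" "fin_gset G X" "fin_gset G (bA S)" "fin_gset G (bB S)"
    "fin_gset G (bA U)" "fin_gset G (bB U)"
    and mp: "gmap G (bA S) (bB S) (bnrm S)" "gmap G (bB S) W (btrf S)"
      "gmap G (bA U) (bB U) (bnrm U)" "gmap G (bB U) X (btrf U)"
    using S U by (auto simp: is_bispan_def)
  obtain \<alpha> \<beta> where \<alpha>: "gmap G (bA U) (bA S) \<alpha>" "inj_on \<alpha> (pts (bA U))"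
    and \<beta>: "gmap G (bB U) (bB S) \<beta>" "inj_on \<beta> (pts (bB U))"
    and im: "\<beta> ` pts (bB U) = {b \<in> pts (bB S). btrf S b \<in> i ` pts X}"
      "\<alpha> ` pts (bA U) = {a \<in> pts (bA S). bnrm S a \<in> \<beta> ` pts (bB U)}"
    and eq: "\<And>a. a \<in> pts (bA U) \<Longrightarrow> bres S (\<alpha> a) = bres U a"
      "\<And>a. a \<in> pts (bA U) \<Longrightarrow> bnrm S (\<alpha> a) = \<beta> (bnrm U a)"
      "\<And>b. b \<in> pts (bB U) \<Longrightarrow> btrf S (\<beta> b) = i (btrf U b)"
    by (rule restricts_toE[OF r]) (rule that; (assumption | blast))
  have "is_pullback G (bB U) (bB S) X W \<beta> (btrf U) (btrf S) i"
    unfolding is_pullback_def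
  proof (intro conjI fin mp \<beta>(1) iW bij_betw_imageI inj_onI equalityI subsetI)
    show "b = b'" if "b \<in> pts (bB U)" "b' \<in> pts (bB U)" "(\<beta> b, btrf U b) = (\<beta> b', btrf U b')" for b b'
      using that inj_onD[OF \<beta>(2)] by blast
    fix z assume "z \<in> {(b, x). b \<in> pts (bB S) \<and> x \<in> pts X \<and> btrf S b = i x}"
    then obtain b x where z: "z = (b, x)" "b \<in> pts (bB S)" "x \<in> pts X" "btrf S b = i x" by blast
    then have "b \<in> \<beta> ` pts (bB U)" unfolding im(1) by blast
    then obtain c where c: "c \<in> pts (bB U)" "b = \<beta> c" by blast
    have "btrf U c = x"
      using eq(3)[OF c(1)] c(2) z gmap_mem[OF mp(4) c(1)] i by (simp add: inj_on_eq_iff)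
    then show "z \<in> (\<lambda>b. (\<beta> b, btrf U b)) ` pts (bB U)" using c z by blast
  qed (use gmap_mem[OF \<beta>(1)] gmap_mem[OF mp(4)] eq(3) in auto)
  moreover have "is_exponential G (bB U) X X (bB U) (bB U) (btrf U) (\<lambda>x. x) (\<lambda>x. x) (\<lambda>x. x) (btrf U)"
    unfolding is_exponential_def
  proof (intro conjI fin mp gmap_id ballI allI impI)
    show "is_pullback G (bB U) X (bB U) X (btrf U \<circ> (\<lambda>x. x)) (\<lambda>x. x) (\<lambda>x. x) (btrf U)"
      unfolding is_pullback_def o_def
      by (intro conjI fin mp gmap_id bij_betw_imageI inj_onI)
         (use gmap_mem[OF mp(4)] in \<open>auto simp: image_iff\<close>)
    show "\<exists>!n. n \<in> pts (bB U) \<and> btrf U n = b \<and> (\<forall>e\<in>pts (bB U). e = n \<longrightarrow> e = s (btrf U e))"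
      if "b \<in> pts X" "\<forall>a\<in>pts X. a = b \<longrightarrow> s a \<in> pts (bB U) \<and> btrf U (s a) = a" for b s
      using that by (intro ex1I[of _ "s b"]) auto
  qed
  moreover have "is_pullback G (bA U) (bA S) (bB U) (bB S) \<alpha> (bnrm U) (bnrm S) (\<beta> \<circ> (\<lambda>x. x))"
    unfolding is_pullback_def o_def
  proof (intro conjI fin mp \<alpha>(1) \<beta>(1) bij_betw_imageI inj_onI equalityI subsetI)
    show "a = a'" if "a \<in> pts (bA U)" "a' \<in> pts (bA U)" "(\<alpha> a, bnrm U a) = (\<alpha> a', bnrm U a')" for a a'
      using that inj_onD[OF \<alpha>(2)] by blast
    fix z assume "z \<in> {(a, b). a \<in> pts (bA S) \<and> b \<in> pts (bB U) \<and> bnrm S a = \<beta> b}"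
    then obtain a b where z: "z = (a, b)" "a \<in> pts (bA S)" "b \<in> pts (bB U)" "bnrm S a = \<beta> b" by blast
    then have "a \<in> \<alpha> ` pts (bA U)" unfolding im(2) by blast
    then obtain c where c: "c \<in> pts (bA U)" "a = \<alpha> c" by blast
    have "bnrm U c = b"
      using eq(2)[OF c(1)] c(2) z gmap_mem[OF mp(3) c(1)] \<beta>(2) by (simp add: inj_on_eq_iff)
    then show "z \<in> (\<lambda>a. (\<alpha> a, bnrm U a)) ` pts (bA U)" using c z by blast
  qed (use gmap_mem[OF \<alpha>(1)] gmap_mem[OF mp(3)] eq(2) in auto)
  moreover have "is_bispan G W X ?T"
    using fin iW by (simp add: is_bispan_def gmap_id)
  ultimately show ?thesis
    by (intro is_compositeI[of G Z W S X ?T U "bB U" \<beta> "btrf U" "bB U" "\<lambda>x. x" "\<lambda>x. x" "btrf U" \<alpha> "bnrm U"])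
      (simp_all add: S U eq)
qed

lemma Cmp_res_span:
  assumes S: "is_bispan G Z W S" and X: "fin_gset G X" and iW: "gmap G X W i" and i: "inj_on i (pts X)"
  shows "Cmp (bispan_cat G) Z W X (res_span G X W i) (bispan_class G Z W S) =
    {U. is_bispan G Z X U \<and> restricts_to G X i S U}"
proof -
  let ?T = "\<lparr>bA = X, bB = X, bres = i, bnrm = (\<lambda>x. x), btrf = (\<lambda>x. x)\<rparr>"
  have W: "fin_gset G W" using S by (simp add: is_bispan_def)
  have T: "?T \<in> bispan_class G W X ?T"
    using X W iW by (simp add: bispan_class_def is_bispan_def gmap_id bispan_iso_refl)
  have SS: "S \<in> bispan_class G Z W S"
    using S by (simp add: bispan_class_def bispan_iso_refl)
  have "(\<exists>S'\<in>bispan_class G Z W S. \<exists>T\<in>bispan_class G W X ?T. is_composite G Z W X T S' U) \<longleftrightarrow>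
      is_bispan G Z X U \<and> restricts_to G X i S U" for U
  proof
    assume "\<exists>S'\<in>bispan_class G Z W S. \<exists>T\<in>bispan_class G W X ?T. is_composite G Z W X T S' U"
    then obtain S' T where S': "is_bispan G Z W S'" "bispan_iso G S S'"
      and T': "bispan_iso G ?T T" and c: "is_composite G Z W X T S' U"
      by (auto simp: bispan_class_def)
    have "restricts_to G X i S' U" by (rule restricts_to_if_composite[OF c T' i])
    then have "restricts_to G X i S U"
      by (rule restricts_to_cong[OF S'(1) bispan_iso_sym[OF S S']])
    then show "is_bispan G Z X U \<and> restricts_to G X i S U"
      using c by (simp add: is_composite_def)
  next
    assume "is_bispan G Z X U \<and> restricts_to G X i S U"
    then show "\<exists>S'\<in>bispan_class G Z W S. \<exists>T\<in>bispan_class G W X ?T. is_composite G Z W X T S' U"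
      using composite_if_restricts_to[OF S _ iW i] SS T by blast
  qed
  then show ?thesis by (simp add: bispan_cat_def res_span_def)
qed

lemma Cmp_res_span_eq_class:
  assumes S: "is_bispan G Z W S" and F: "is_bispan G Z X F"
    and iW: "gmap G X W i" and i: "inj_on i (pts X)" and r: "restricts_to G X i S F"
  shows "Cmp (bispan_cat G) Z W X (res_span G X W i) (bispan_class G Z W S) = bispan_class G Z X F"
proof -
  have "fin_gset G X" using F by (simp add: is_bispan_def)
  note eq = Cmp_res_span[OF S this iW i]
  show ?thesis
    unfolding eq unfolding bispan_class_def
    using restricts_to_iso[OF F _ _ r] restricts_to_unique[OF F _ i r] by blast
qed

section \<open>Finite products of bispans\<close>

definition sum_bispan :: "'g bispan \<Rightarrow> 'g bispan \<Rightarrow> 'g bispan" where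
  "sum_bispan F F' =
     \<lparr>bA = disj_union (bA F) (bA F'), bB = disj_union (bB F) (bB F'),
      bres = copair (bres F) (bres F'),
      bnrm = copair (in_left \<circ> bnrm F) (in_right \<circ> bnrm F'),
      btrf = copair (in_left \<circ> btrf F) (in_right \<circ> btrf F')\<rparr>"

lemma is_bispan_sum:
  assumes "is_bispan G Z X F" "is_bispan G Z Y F'"
  shows "is_bispan G Z (disj_union X Y) (sum_bispan F F')"
  using assms unfolding is_bispan_def sum_bispan_def
  by (auto intro!: fin_gset_disj_union gmap_copair gmap_comp[OF _ gmap_in_left] gmap_comp[OF _ gmap_in_right])

lemma sum_restricts_to_left:
  assumes F: "is_bispan G Z X F"
  shows "restricts_to G X in_left (sum_bispan F F') F"
proof (rule restricts_toI)
  show "gmap G (bA F) (bA (sum_bispan F F')) in_left" "gmap G (bB F) (bB (sum_bispan F F')) in_left"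
    by (simp_all add: sum_bispan_def gmap_in_left)
  show "inj_on in_left (pts (bA F))" "inj_on in_left (pts (bB F))"
    by (rule inj_in_left)+
  show "in_left ` pts (bB F) = {b \<in> pts (bB (sum_bispan F F')). btrf (sum_bispan F F') b \<in> in_left ` pts X}"
    using F by (auto simp: sum_bispan_def pts_disj_union is_bispan_def dest: gmap_mem)
  show "in_left ` pts (bA F) =
      {a \<in> pts (bA (sum_bispan F F')). bnrm (sum_bispan F F') a \<in> in_left ` pts (bB F)}"
    using F by (auto simp: sum_bispan_def pts_disj_union is_bispan_def dest: gmap_mem)
qed (simp_all add: sum_bispan_def)

lemma sum_restricts_to_right:
  assumes F': "is_bispan G Z Y F'"
  shows "restricts_to G Y in_right (sum_bispan F F') F'"
proof (rule restricts_toI)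
  show "gmap G (bA F') (bA (sum_bispan F F')) in_right" "gmap G (bB F') (bB (sum_bispan F F')) in_right"
    by (simp_all add: sum_bispan_def gmap_in_right)
  show "inj_on in_right (pts (bA F'))" "inj_on in_right (pts (bB F'))"
    by (rule inj_in_right)+
  show "in_right ` pts (bB F') = {b \<in> pts (bB (sum_bispan F F')). btrf (sum_bispan F F') b \<in> in_right ` pts Y}"
    using F' by (auto simp: sum_bispan_def pts_disj_union is_bispan_def dest: gmap_mem)
  show "in_right ` pts (bA F') =
      {a \<in> pts (bA (sum_bispan F F')). bnrm (sum_bispan F F') a \<in> in_right ` pts (bB F')}"
    using F' by (auto simp: sum_bispan_def pts_disj_union is_bispan_def dest: gmap_mem)
qed (simp_all add: sum_bispan_def)

text \<open>A bispan into a disjoint union is the sum of its parts over the two summands, because the preimages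
  of the summands partition \<open>bB S\<close>, and therefore also \<open>bA S\<close>.\<close>

lemma iso_sum_if_restricts_to:
  assumes S: "is_bispan G Z (disj_union X Y) S"
    and F: "is_bispan G Z X F" "restricts_to G X in_left S F"
    and F': "is_bispan G Z Y F'" "restricts_to G Y in_right S F'"
  shows "bispan_iso G (sum_bispan F F') S"
proof -
  have nrm: "gmap G (bA S) (bB S) (bnrm S)" and trf: "gmap G (bB S) (disj_union X Y) (btrf S)"
    using S by (auto simp: is_bispan_def)
  obtain \<alpha> \<beta> where 1: "gmap G (bA F) (bA S) \<alpha>" "inj_on \<alpha> (pts (bA F))"
    "gmap G (bB F) (bB S) \<beta>" "inj_on \<beta> (pts (bB F))"
    "\<beta> ` pts (bB F) = {b \<in> pts (bB S). btrf S b \<in> in_left ` pts X}"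
    "\<alpha> ` pts (bA F) = {a \<in> pts (bA S). bnrm S a \<in> \<beta> ` pts (bB F)}"
    "\<And>a. a \<in> pts (bA F) \<Longrightarrow> bres S (\<alpha> a) = bres F a"
    "\<And>a. a \<in> pts (bA F) \<Longrightarrow> bnrm S (\<alpha> a) = \<beta> (bnrm F a)"
    "\<And>b. b \<in> pts (bB F) \<Longrightarrow> btrf S (\<beta> b) = in_left (btrf F b)"
    by (rule restricts_toE[OF F(2)]) (rule that; (assumption | blast))
  obtain \<alpha>' \<beta>' where 2: "gmap G (bA F') (bA S) \<alpha>'" "inj_on \<alpha>' (pts (bA F'))"
    "gmap G (bB F') (bB S) \<beta>'" "inj_on \<beta>' (pts (bB F'))"
    "\<beta>' ` pts (bB F') = {b \<in> pts (bB S). btrf S b \<in> in_right ` pts Y}"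
    "\<alpha>' ` pts (bA F') = {a \<in> pts (bA S). bnrm S a \<in> \<beta>' ` pts (bB F')}"
    "\<And>a. a \<in> pts (bA F') \<Longrightarrow> bres S (\<alpha>' a) = bres F' a"
    "\<And>a. a \<in> pts (bA F') \<Longrightarrow> bnrm S (\<alpha>' a) = \<beta>' (bnrm F' a)"
    "\<And>b. b \<in> pts (bB F') \<Longrightarrow> btrf S (\<beta>' b) = in_right (btrf F' b)"
    by (rule restricts_toE[OF F'(2)]) (rule that; (assumption | blast))
  have B: "\<beta> ` pts (bB F) \<inter> \<beta>' ` pts (bB F') = {}" "\<beta> ` pts (bB F) \<union> \<beta>' ` pts (bB F') = pts (bB S)"
    using gmap_mem[OF trf] unfolding 1(5) 2(5) pts_disj_union by auto
  have A: "\<alpha> ` pts (bA F) \<inter> \<alpha>' ` pts (bA F') = {}" "\<alpha> ` pts (bA F) \<union> \<alpha>' ` pts (bA F') = pts (bA S)"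
    using B gmap_mem[OF nrm] unfolding 1(6) 2(6) by blast+
  show ?thesis
  proof (rule bispan_isoI)
    show "gmap G (bA (sum_bispan F F')) (bA S) (copair \<alpha> \<alpha>')"
      "gmap G (bB (sum_bispan F F')) (bB S) (copair \<beta> \<beta>')"
      by (simp_all add: sum_bispan_def gmap_copair 1(1,3) 2(1,3))
    show "bij_betw (copair \<alpha> \<alpha>') (pts (bA (sum_bispan F F'))) (pts (bA S))"
      "bij_betw (copair \<beta> \<beta>') (pts (bB (sum_bispan F F'))) (pts (bB S))"
      unfolding sum_bispan_def bispan.simps pts_disj_union
      by (rule bij_betw_copair[OF 1(2) 2(2) A], rule bij_betw_copair[OF 1(4) 2(4) B])
  qed (auto simp: sum_bispan_def pts_disj_union 1(7-9) 2(7-9))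
qed

text \<open>Composing with the two restrictions sends a bispan into \<open>X \<squnion> Y\<close> to its parts over \<open>X\<close> and \<open>Y\<close>;
  these determine the bispan up to isomorphism, and they can be prescribed arbitrarily by forming a sum.\<close>

lemma disj_union_is_product:
  assumes X: "fin_gset G X" and Y: "fin_gset G Y"
  shows "is_product (bispan_cat G) X Y (disj_union X Y)
           (res_span G X (disj_union X Y) in_left) (res_span G Y (disj_union X Y) in_right)"
    (is "is_product ?C X Y ?W ?p ?q")
proof -
  have W: "fin_gset G ?W" by (rule fin_gset_disj_union[OF X Y])
  have p: "?p \<in> Hom ?C ?W X"
    unfolding bispan_cat_def res_span_def
    using X W gmap_in_left[of G X Y] by (auto simp: is_bispan_def gmap_id)
  have q: "?q \<in> Hom ?C ?W Y"
    unfolding bispan_cat_def res_span_def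
    using Y W gmap_in_right[of G Y X] by (auto simp: is_bispan_def gmap_id)
  have "\<exists>!h. h \<in> Hom ?C Z ?W \<and> Cmp ?C Z ?W X ?p h = f \<and> Cmp ?C Z ?W Y ?q h = g"
    if fg: "f \<in> Hom ?C Z X" "g \<in> Hom ?C Z Y" for Z f g
  proof -
    obtain F F' where F: "is_bispan G Z X F" "f = bispan_class G Z X F"
      and F': "is_bispan G Z Y F'" "g = bispan_class G Z Y F'"
      using fg by (auto simp: bispan_cat_def)
    let ?S = "sum_bispan F F'"
    have S: "is_bispan G Z ?W ?S" by (rule is_bispan_sum[OF F(1) F'(1)])
    show ?thesis
    proof (rule ex1I[of _ "bispan_class G Z ?W ?S"], intro conjI)
      show "bispan_class G Z ?W ?S \<in> Hom ?C Z ?W"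
        using S by (auto simp: bispan_cat_def)
      show "Cmp ?C Z ?W X ?p (bispan_class G Z ?W ?S) = f"
        unfolding F(2)
        by (rule Cmp_res_span_eq_class[OF S F(1) gmap_in_left inj_in_left
              sum_restricts_to_left[OF F(1)]])
      show "Cmp ?C Z ?W Y ?q (bispan_class G Z ?W ?S) = g"
        unfolding F'(2)
        by (rule Cmp_res_span_eq_class[OF S F'(1) gmap_in_right inj_in_right
              sum_restricts_to_right[OF F'(1)]])
    next
      fix h assume h: "h \<in> Hom ?C Z ?W \<and> Cmp ?C Z ?W X ?p h = f \<and> Cmp ?C Z ?W Y ?q h = g"
      then obtain S' where S': "is_bispan G Z ?W S'" "h = bispan_class G Z ?W S'"
        by (auto simp: bispan_cat_def)
      have "F \<in> f" "F' \<in> g"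
        using F F' by (simp_all add: bispan_class_def bispan_iso_refl)
      then have "restricts_to G X in_left S' F" "restricts_to G Y in_right S' F'"
        using h Cmp_res_span[OF S'(1) X gmap_in_left inj_in_left]
          Cmp_res_span[OF S'(1) Y gmap_in_right inj_in_right]
        unfolding S'(2) by auto
      then have "bispan_iso G ?S S'"
        by (intro iso_sum_if_restricts_to[OF S'(1) F(1) _ F'(1)])
      then show "h = bispan_class G Z ?W ?S"
        using bispan_class_eq_iff[OF S S'(1)] S'(2) by simp
    qed
  qed
  moreover have "Obj ?C = {X. fin_gset G X}" by (simp add: bispan_cat_def)
  ultimately show ?thesis
    unfolding is_product_def using X Y W p q by simp
qed

lemma empty_gset_is_terminal:
  assumes "group G"
  shows "is_terminal (bispan_cat G) empty_gset"
proof -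
  note e = fin_gset_empty[OF assms]
  have "\<exists>!h. h \<in> Hom (bispan_cat G) Z empty_gset" if Z: "fin_gset G Z" for Z
  proof -
    let ?S = "\<lparr>bA = empty_gset, bB = empty_gset, bres = (\<lambda>x. x), bnrm = (\<lambda>x. x), btrf = (\<lambda>x. x)\<rparr>"
    have S: "is_bispan G Z empty_gset ?S"
      using Z e by (simp add: is_bispan_def gmap_from_empty)
    have "bispan_class G Z empty_gset S' = bispan_class G Z empty_gset ?S"
      if S': "is_bispan G Z empty_gset S'" for S'
    proof -
      have "pts (bB S') = {}"
        using S' by (auto simp: is_bispan_def dest: gmap_mem)
      moreover from this have "pts (bA S') = {}"
        using S' by (auto simp: is_bispan_def dest: gmap_mem)
      ultimately have "bispan_iso G ?S S'"
        by (intro bispan_isoI[of _ _ _ "\<lambda>x. x" "\<lambda>x. x"]) (simp_all add: gmap_from_empty bij_betw_def)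
      then show ?thesis using bispan_class_eq_iff[OF S S'] by simp
    qed
    then show ?thesis
      using S by (auto simp: bispan_cat_def)
  qed
  then show ?thesis
    using e by (simp add: is_terminal_def) (simp add: bispan_cat_def)
qed

text \<open>The transfer from the empty set is represented by an empty bispan, and a part of an empty bispan is
  empty. For the level rings this says that restriction along \<open>i\<close> preserves zero.\<close>

lemma Cmp_res_span_trf_empty:
  assumes X: "fin_gset G X" and Y: "fin_gset G Y" and i: "gmap G X Y i" "inj_on i (pts X)"
  shows "Cmp (bispan_cat G) empty_gset Y X (res_span G X Y i) (trf_span G empty_gset Y (\<lambda>x. x)) =
    trf_span G empty_gset X (\<lambda>x. x)"
  unfolding trf_span_def
proof (rule Cmp_res_span_eq_class[OF _ _ i])
  note e = fin_gset_empty[OF fin_gset_group[OF X]]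
  show "is_bispan G empty_gset Y \<lparr>bA = empty_gset, bB = empty_gset, bres = \<lambda>x. x, bnrm = \<lambda>x. x, btrf = \<lambda>x. x\<rparr>"
    "is_bispan G empty_gset X \<lparr>bA = empty_gset, bB = empty_gset, bres = \<lambda>x. x, bnrm = \<lambda>x. x, btrf = \<lambda>x. x\<rparr>"
    using e X Y by (simp_all add: is_bispan_def gmap_from_empty)
qed (rule restricts_toI[of _ _ _ "\<lambda>x. x" "\<lambda>x. x"]; simp add: gmap_from_empty)

section \<open>The level rings of a product-preserving functor\<close>

abbreviation product_functor :: "('g, 'm) monoid_scheme \<Rightarrow> ('g, 'a) bispan_functor \<Rightarrow> bool" where
  "product_functor G R \<equiv> is_functor (bispan_cat G) set_cat R \<and>
     preserves_finite_products (bispan_cat G) set_cat R"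

lemma Obj_bispan_cat [simp]: "X \<in> Obj (bispan_cat G) \<longleftrightarrow> fin_gset G X"
  by (simp add: bispan_cat_def)

lemma res_span_Hom:
  "fin_gset G X \<Longrightarrow> fin_gset G Y \<Longrightarrow> gmap G X Y f \<Longrightarrow> res_span G X Y f \<in> Hom (bispan_cat G) Y X"
  by (auto simp: bispan_cat_def res_span_def is_bispan_def gmap_id)

lemma norm_span_Hom:
  "fin_gset G X \<Longrightarrow> fin_gset G Y \<Longrightarrow> gmap G X Y f \<Longrightarrow> norm_span G X Y f \<in> Hom (bispan_cat G) X Y"
  by (auto simp: bispan_cat_def norm_span_def is_bispan_def gmap_id)

lemma trf_span_Hom:
  "fin_gset G X \<Longrightarrow> fin_gset G Y \<Longrightarrow> gmap G X Y f \<Longrightarrow> trf_span G X Y f \<in> Hom (bispan_cat G) X Y"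
  by (auto simp: bispan_cat_def trf_span_def is_bispan_def gmap_id)

lemma tpair_ex1:
  assumes R: "product_functor G R" and X: "fin_gset G X" and ab: "a \<in> fobj R X" "b \<in> fobj R X"
  shows "\<exists>!c. c \<in> fobj R (disj_union X X) \<and>
      fmap R (disj_union X X) X (res_span G X (disj_union X X) in_left) c = a \<and>
      fmap R (disj_union X X) X (res_span G X (disj_union X X) in_right) c = b"
  using R disj_union_is_product[OF X X] ab
  by (simp add: preserves_finite_products_def is_product_set_cat_iff)

lemma tpair:
  assumes "product_functor G R" "fin_gset G X" "a \<in> fobj R X" "b \<in> fobj R X"
  shows "tpair G R X a b \<in> fobj R (disj_union X X)"
    and "fmap R (disj_union X X) X (res_span G X (disj_union X X) in_left) (tpair G R X a b) = a"
    and "fmap R (disj_union X X) X (res_span G X (disj_union X X) in_right) (tpair G R X a b) = b"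
  using theI'[OF tpair_ex1[OF assms]] unfolding tpair_def by blast+

lemma tpair_eqI:
  assumes "product_functor G R" "fin_gset G X" and c: "c \<in> fobj R (disj_union X X)"
    and "fmap R (disj_union X X) X (res_span G X (disj_union X X) in_left) c = a" "a \<in> fobj R X"
    and "fmap R (disj_union X X) X (res_span G X (disj_union X X) in_right) c = b" "b \<in> fobj R X"
  shows "tpair G R X a b = c"
  unfolding tpair_def using assms by (intro the1_equality tpair_ex1) auto

lemma fobj_empty:
  assumes "group G" "product_functor G R"
  shows "fobj R empty_gset = {tpoint R}"
proof -
  have "is_terminal set_cat (fobj R empty_gset)"
    using assms(2) empty_gset_is_terminal[OF assms(1)] by (simp add: preserves_finite_products_def)
  then obtain t where "fobj R empty_gset = {t}" by (auto simp: is_terminal_set_cat_iff)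
  then show ?thesis by (simp add: tpoint_def)
qed

lemma level_ring_zero_closed:
  assumes "group G" "product_functor G R" "fin_gset G X"
  shows "\<zero>\<^bsub>level_ring G R X\<^esub> \<in> carrier (level_ring G R X)"
proof -
  note e = fin_gset_empty[OF assms(1)]
  have t: "tpoint R \<in> fobj R empty_gset" using fobj_empty[OF assms(1,2)] by simp
  show ?thesis
    using fmap_set_cat_mem[OF _ _ _ trf_span_Hom[OF e assms(3) gmap_from_empty] t] assms(2,3) e
    by (simp add: level_ring_def)
qed

context
  fixes G :: "('g, 'm) monoid_scheme" and R S :: "('g, 'a) bispan_functor" and \<eta>
  assumes R: "product_functor G R" and S: "product_functor G S"
    and \<eta>: "\<eta> \<in> nat_trans (bispan_cat G) set_cat R S"
begin

text \<open>Pairs are characterized by their restrictions to the two summands, and natural transformations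
  commute with restrictions. All ring operations are arrows applied to pairs, or to the point of
  \<open>R \<emptyset>\<close>, so natural transformations respect them.\<close>

lemma nat_trans_tpair:
  assumes X: "fin_gset G X" and ab: "a \<in> fobj R X" "b \<in> fobj R X"
  shows "\<eta> (disj_union X X) (tpair G R X a b) = tpair G S X (\<eta> X a) (\<eta> X b)"
proof -
  note W = fin_gset_disj_union[OF X X]
  note t = tpair[OF R X ab]
  have "tpair G S X (\<eta> X a) (\<eta> X b) = \<eta> (disj_union X X) (tpair G R X a b)"
  proof (rule tpair_eqI[OF S X])
    show "\<eta> (disj_union X X) (tpair G R X a b) \<in> fobj S (disj_union X X)"
      "\<eta> X a \<in> fobj S X" "\<eta> X b \<in> fobj S X"
      using nat_trans_mem[OF \<eta>] W X t ab by simp_all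
    show "fmap S (disj_union X X) X (res_span G X (disj_union X X) in_left)
        (\<eta> (disj_union X X) (tpair G R X a b)) = \<eta> X a"
      using nat_trans_natural[OF \<eta> _ _ res_span_Hom[OF X W gmap_in_left] t(1)] W X t(2) by simp
    show "fmap S (disj_union X X) X (res_span G X (disj_union X X) in_right)
        (\<eta> (disj_union X X) (tpair G R X a b)) = \<eta> X b"
      using nat_trans_natural[OF \<eta> _ _ res_span_Hom[OF X W gmap_in_right] t(1)] W X t(3) by simp
  qed
  then show ?thesis ..
qed

lemma nat_trans_level_ring:
  assumes X: "fin_gset G X"
    and ab: "a \<in> carrier (level_ring G R X)" "b \<in> carrier (level_ring G R X)"
  shows "\<eta> X a \<in> carrier (level_ring G S X)"
    and "\<eta> X (a \<otimes>\<^bsub>level_ring G R X\<^esub> b) = \<eta> X a \<otimes>\<^bsub>level_ring G S X\<^esub> \<eta> X b"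
    and "\<eta> X (a \<oplus>\<^bsub>level_ring G R X\<^esub> b) = \<eta> X a \<oplus>\<^bsub>level_ring G S X\<^esub> \<eta> X b"
proof -
  note W = fin_gset_disj_union[OF X X]
  have ab': "a \<in> fobj R X" "b \<in> fobj R X" using ab by (simp_all add: level_ring_def)
  note t = tpair(1)[OF R X ab']
  show "\<eta> X a \<in> carrier (level_ring G S X)"
    using nat_trans_mem[OF \<eta> _ ab'(1)] X by (simp add: level_ring_def)
  show "\<eta> X (a \<otimes>\<^bsub>level_ring G R X\<^esub> b) = \<eta> X a \<otimes>\<^bsub>level_ring G S X\<^esub> \<eta> X b"
    using nat_trans_natural[OF \<eta> _ _ norm_span_Hom[OF W X gmap_fold_map] t] W X nat_trans_tpair[OF X ab']
    by (simp add: level_ring_def)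
  show "\<eta> X (a \<oplus>\<^bsub>level_ring G R X\<^esub> b) = \<eta> X a \<oplus>\<^bsub>level_ring G S X\<^esub> \<eta> X b"
    using nat_trans_natural[OF \<eta> _ _ trf_span_Hom[OF W X gmap_fold_map] t] W X nat_trans_tpair[OF X ab']
    by (simp add: level_ring_def)
qed

lemma nat_trans_zero:
  assumes G: "group G" and X: "fin_gset G X"
  shows "\<eta> X \<zero>\<^bsub>level_ring G R X\<^esub> = \<zero>\<^bsub>level_ring G S X\<^esub>"
proof -
  note e = fin_gset_empty[OF G]
  have t: "tpoint R \<in> fobj R empty_gset" using fobj_empty[OF G R] by simp
  have "\<eta> empty_gset (tpoint R) \<in> fobj S empty_gset"
    using nat_trans_mem[OF \<eta> _ t] e by simp
  then have "\<eta> empty_gset (tpoint R) = tpoint S"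
    using fobj_empty[OF G S] by simp
  then show ?thesis
    using nat_trans_natural[OF \<eta> _ _ trf_span_Hom[OF e X gmap_from_empty] t] e X
    by (simp add: level_ring_def)
qed

end

lemma gmap_right_mult:
  assumes "group G" "g \<in> carrier G"
  shows "gmap G (free_orbit G) (free_orbit G) (\<lambda>x. (fst x \<otimes>\<^bsub>G\<^esub> g, 0))"
    and "inj_on (\<lambda>x. (fst x \<otimes>\<^bsub>G\<^esub> g, 0)) (pts (free_orbit G))"
proof -
  interpret group G by (rule assms)
  show "gmap G (free_orbit G) (free_orbit G) (\<lambda>x. (fst x \<otimes>\<^bsub>G\<^esub> g, 0))"
    using assms by (auto simp: gmap_def free_orbit_def m_assoc)
  show "inj_on (\<lambda>x. (fst x \<otimes>\<^bsub>G\<^esub> g, 0)) (pts (free_orbit G))"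
    using assms by (auto simp: inj_on_def free_orbit_def)
qed

context
  fixes G :: "('g, 'm) monoid_scheme"
  assumes G: "group G" and fin: "finite (carrier G)"
begin

lemma free_action_span_Hom:
  "g \<in> carrier G \<Longrightarrow> res_span G (free_orbit G) (free_orbit G) (\<lambda>x. (fst x \<otimes>\<^bsub>G\<^esub> g, 0)) \<in>
     Hom (bispan_cat G) (free_orbit G) (free_orbit G)"
  using fin_gset_free_orbit[OF G fin] gmap_right_mult(1)[OF G] by (simp add: res_span_Hom)

lemma nat_trans_free_action:
  assumes "\<eta> \<in> nat_trans (bispan_cat G) set_cat R S" "g \<in> carrier G" "a \<in> fobj R (free_orbit G)"
  shows "\<eta> (free_orbit G) (free_action G R g a) = free_action G S g (\<eta> (free_orbit G) a)"
  unfolding free_action_def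
  using fin_gset_free_orbit[OF G fin]
  by (intro nat_trans_natural[OF assms(1) _ _ free_action_span_Hom[OF assms(2)] assms(3)]) simp_all

lemma free_action_closed:
  assumes "product_functor G R" "g \<in> carrier G" "a \<in> fobj R (free_orbit G)"
  shows "free_action G R g a \<in> fobj R (free_orbit G)"
  unfolding free_action_def
  using assms(1) fin_gset_free_orbit[OF G fin]
  by (intro fmap_set_cat_mem[OF _ _ _ free_action_span_Hom[OF assms(2)] assms(3)]) simp_all

lemma free_action_zero:
  assumes R: "product_functor G R" and g: "g \<in> carrier G"
  shows "free_action G R g \<zero>\<^bsub>level_ring G R (free_orbit G)\<^esub> = \<zero>\<^bsub>level_ring G R (free_orbit G)\<^esub>"
proof -
  note X = fin_gset_free_orbit[OF G fin] and e = fin_gset_empty[OF G]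
  have t: "tpoint R \<in> fobj R empty_gset" using fobj_empty[OF G R] by simp
  show ?thesis
    using fmap_set_cat_Cmp[OF _ _ _ _ trf_span_Hom[OF e X gmap_from_empty[where f = "\<lambda>x. x"]]
        free_action_span_Hom[OF g] t]
      Cmp_res_span_trf_empty[OF X X gmap_right_mult[OF G g]] R e X
    by (simp add: level_ring_def free_action_def)
qed

end

section \<open>Quotients of Tambara functors\<close>

text \<open>The level groups of \<open>Q\<close> are homomorphic images of those of \<open>R\<close>.\<close>

lemma is_tambara_image:
  fixes R Q :: "('g, 'a) bispan_functor"
  assumes R: "is_tambara G R" and Q: "product_functor G Q"
    and \<eta>: "\<eta> \<in> nat_trans (bispan_cat G) set_cat R Q"
    and surj: "\<And>X. fin_gset G X \<Longrightarrow> fobj Q X = \<eta> X ` fobj R X"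
  shows "is_tambara G Q"
proof -
  have R': "product_functor G R" using R by (simp add: is_tambara_def)
  have "group (add_monoid (level_ring G Q X))" if X: "fin_gset G X" for X
  proof -
    let ?A = "add_monoid (level_ring G R X)" and ?B = "add_monoid (level_ring G Q X)"
    have A: "group ?A" using R X by (simp add: is_tambara_def)
    have hom: "\<eta> X \<in> hom ?A ?B"
      using nat_trans_level_ring[OF R' Q \<eta> X] by (auto intro!: homI)
    have "carrier ?B = \<eta> X ` carrier ?A"
      using surj[OF X] by (simp add: level_ring_def)
    moreover have "\<one>\<^bsub>?B\<^esub> = \<eta> X \<one>\<^bsub>?A\<^esub>"
      using nat_trans_zero[OF R' Q \<eta> fin_gset_group[OF X] X] by simp
    ultimately have "?B = ?B\<lparr>carrier := \<eta> X ` carrier ?A, one := \<eta> X \<one>\<^bsub>?A\<^esub>\<rparr>"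
      by simp
    then show ?thesis
      using group.hom_imp_img_group[OF A hom] by simp
  qed
  with Q show ?thesis by (simp add: is_tambara_def)
qed

section \<open>Clarified Tambara functors\<close>

lemma carrier_mem_if_upward_closed:
  assumes "group G" "\<Lambda> \<subseteq> {H. subgroup H G}" "upward_closed G \<Lambda>" "\<Lambda> \<noteq> {}"
  shows "carrier G \<in> \<Lambda>"
proof -
  interpret group G by (rule assms)
  obtain H where H: "H \<in> \<Lambda>" using assms(4) by blast
  then have "H \<subseteq> carrier G" using assms(2) subgroup.subset by blast
  then have "(\<one>\<^bsub>G\<^esub> <#\<^bsub>G\<^esub> H) #>\<^bsub>G\<^esub> inv\<^bsub>G\<^esub> \<one>\<^bsub>G\<^esub> \<subseteq> carrier G"
    by (intro r_coset_subset_G l_coset_subset_G) auto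
  then have "subconjugate G H (carrier G)"
    unfolding subconjugate_def by blast
  then show ?thesis
    using assms(3) H subgroup_self by (auto simp: upward_closed_def)
qed

text \<open>Let \<open>d\<close> be an idempotent of type \<open>L\<close> and \<open>d'\<close> its image under some \<open>\<eta>\<close>. The isotropy group of \<open>d'\<close>
  contains \<open>L\<close>. If it contains some \<open>g \<notin> L\<close>, then \<open>d' = d' \<cdot> d' = d' \<cdot> g d' = 0\<close>. So \<open>d'\<close> is either zero or
  again of type \<open>L\<close>, and in the latter case \<open>L \<in> \<Lambda>\<close> since the target is clarified. If all images of
  \<open>d\<close> vanish, then \<open>d = 0\<close> by faithfulness, and \<open>0\<close> has the isotropy group \<open>G\<close>.\<close>

lemma clarified_if_jointly_faithful:
  fixes Q :: "('g, 'a) bispan_functor"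
  assumes G: "group G" and fin: "finite (carrier G)" and \<Lambda>: "carrier G \<in> \<Lambda>"
    and Q: "product_functor G Q"
    and K: "\<And>S \<eta>. (S, \<eta>) \<in> K \<Longrightarrow>
        product_functor G S \<and> clarified G \<Lambda> S \<and> \<eta> \<in> nat_trans (bispan_cat G) set_cat Q S"
    and faithful: "\<And>a b. a \<in> fobj Q (free_orbit G) \<Longrightarrow> b \<in> fobj Q (free_orbit G) \<Longrightarrow>
        (\<And>S \<eta>. (S, \<eta>) \<in> K \<Longrightarrow> \<eta> (free_orbit G) a = \<eta> (free_orbit G) b) \<Longrightarrow> a = b"
  shows "clarified G \<Lambda> Q"
  unfolding clarified_def clarified_ring_def
proof (intro allI impI, elim conjE)
  fix L d
  let ?O = "free_orbit G"
  let ?Q = "level_ring G Q ?O"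
  assume L: "subgroup L G" and d: "idempotent_of_type G ?Q (free_action G Q) L d"
  note O = fin_gset_free_orbit[OF G fin]
  have dQ: "d \<in> carrier ?Q" "d \<otimes>\<^bsub>?Q\<^esub> d = d" "stabilizer G (free_action G Q) d = L"
    and orth: "\<And>g. g \<in> carrier G \<Longrightarrow> g \<notin> L \<Longrightarrow> d \<otimes>\<^bsub>?Q\<^esub> free_action G Q g d = \<zero>\<^bsub>?Q\<^esub>"
    using d by (auto simp: idempotent_of_type_def)
  have dO: "d \<in> fobj Q ?O" using dQ(1) by (simp add: level_ring_def)
  have stab: "g \<in> L \<longleftrightarrow> g \<in> carrier G \<and> free_action G Q g d = d" for g
    using dQ(3) by (auto simp: stabilizer_def)
  show "L \<in> \<Lambda>"
  proof (cases "\<exists>S \<eta>. (S, \<eta>) \<in> K \<and> \<eta> ?O d \<noteq> \<zero>\<^bsub>level_ring G S ?O\<^esub>")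
    case True
    then obtain S \<eta> where k: "(S, \<eta>) \<in> K" and nz: "\<eta> ?O d \<noteq> \<zero>\<^bsub>level_ring G S ?O\<^esub>" by blast
    let ?S = "level_ring G S ?O" and ?d = "\<eta> ?O d"
    have S: "product_functor G S" "clarified G \<Lambda> S" and \<eta>: "\<eta> \<in> nat_trans (bispan_cat G) set_cat Q S"
      using K[OF k] by auto
    note ring = nat_trans_level_ring[OF Q S(1) \<eta> O]
    have idem: "?d \<otimes>\<^bsub>?S\<^esub> ?d = ?d"
      using ring(2)[OF dQ(1) dQ(1)] dQ(2) by simp
    have orth': "?d \<otimes>\<^bsub>?S\<^esub> free_action G S g ?d = \<zero>\<^bsub>?S\<^esub>" if g: "g \<in> carrier G" "g \<notin> L" for g
    proof -
      have "free_action G Q g d \<in> carrier ?Q"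
        using free_action_closed[OF G fin Q g(1) dO] by (simp add: level_ring_def)
      from ring(2)[OF dQ(1) this]
      have "?d \<otimes>\<^bsub>?S\<^esub> \<eta> ?O (free_action G Q g d) = \<eta> ?O \<zero>\<^bsub>?Q\<^esub>"
        using orth[OF g] by simp
      then show ?thesis
        using nat_trans_zero[OF Q S(1) \<eta> G O] nat_trans_free_action[OF G fin \<eta> g(1) dO] by simp
    qed
    have "stabilizer G (free_action G S) ?d = L"
    proof (intro equalityI subsetI)
      fix g assume "g \<in> stabilizer G (free_action G S) ?d"
      then have g: "g \<in> carrier G" "free_action G S g ?d = ?d" by (auto simp: stabilizer_def)
      then show "g \<in> L" using orth'[of g] idem nz by auto
    next
      fix g assume "g \<in> L"
      then show "g \<in> stabilizer G (free_action G S) ?d"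
        using stab[of g] nat_trans_free_action[OF G fin \<eta> _ dO, of g] by (simp add: stabilizer_def)
    qed
    then have "idempotent_of_type G ?S (free_action G S) L ?d"
      unfolding idempotent_of_type_def using ring(1)[OF dQ(1) dQ(1)] idem orth' by blast
    then show ?thesis
      using S(2) L by (auto simp: clarified_def clarified_ring_def)
  next
    case False
    have zero: "\<zero>\<^bsub>?Q\<^esub> \<in> fobj Q ?O"
      using level_ring_zero_closed[OF G Q O] by (simp add: level_ring_def)
    have "d = \<zero>\<^bsub>?Q\<^esub>"
      using False K nat_trans_zero[OF Q _ _ G O] by (intro faithful[OF dO zero]) metis
    then have "L = carrier G"
      using stab free_action_zero[OF G fin Q] by blast
    then show ?thesis using \<Lambda> by simp
  qed
qed

theorem proposition4p11:
  fixes G :: "('g, 'm) monoid_scheme" and \<Lambda> :: "'g set set"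
  assumes "group G" and "finite (carrier G)"
    and "\<Lambda> \<subseteq> {H. subgroup H G}" and "upward_closed G \<Lambda>" and "\<Lambda> \<noteq> {}"
  shows "reflective_subcategory
           (Tamb G :: (('g, 'a) bispan_functor, 'g gset \<Rightarrow> 'a \<Rightarrow> 'a) cat)
           {R. clarified G \<Lambda> R}"
proof (rule reflective_subcategoryI)
  let ?B = "bispan_cat G"
  let ?T = "Tamb G :: (('g, 'a) bispan_functor, 'g gset \<Rightarrow> 'a \<Rightarrow> 'a) cat"
  show "is_category ?T"
    unfolding Tamb_def
    by (intro is_category_full_subcategory is_category_functor_cat is_category_set_cat)
  have Obj: "R \<in> Obj ?T \<longleftrightarrow> is_tambara G R" for R
    by (auto simp: Tamb_def full_subcategory_def functor_cat_def is_tambara_def)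
  have Hom: "Hom ?T = nat_trans ?B set_cat" and Cmp: "Cmp ?T = Cmp (functor_cat ?B set_cat)"
    by (simp_all add: Tamb_def full_subcategory_def functor_cat_def)
  fix R :: "('g, 'a) bispan_functor"
  assume "R \<in> Obj ?T"
  then have R: "is_tambara G R" by (simp add: Obj)
  then have R': "product_functor G R" by (simp add: is_tambara_def)
  \<comment> \<open>all morphisms from \<open>R\<close> to clarified functors; their joint kernel is the congruence to divide by\<close>
  define K where
    "K = {(S, \<eta>). is_tambara G S \<and> clarified G \<Lambda> S \<and> \<eta> \<in> nat_trans ?B set_cat R S}"
  have K: "\<eta> \<in> nat_trans ?B set_cat R S \<and> product_functor G S" if "(S, \<eta>) \<in> K" for S \<eta>
    using that by (simp add: K_def is_tambara_def)
  interpret functor_congruence ?B R "joint_kernel R K"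
    using R' K by (intro functor_congruence_joint_kernel) auto
  have quot: "product_functor G quot"
  proof (intro conjI is_functor_quot preserves_finite_products_quot)
    show "preserves_finite_products ?B set_cat R" using R' by simp
    show "(a, b) \<in> joint_kernel R K P"
      if "is_product ?B X Y P p q" "a \<in> fobj R P" "b \<in> fobj R P"
        "(fmap R P X p a, fmap R P X p b) \<in> joint_kernel R K X"
        "(fmap R P Y q a, fmap R P Y q b) \<in> joint_kernel R K Y" for X Y P p q a b
      using joint_kernel_product[OF is_functor _ that] K by blast
  qed
  have tamb: "is_tambara G quot"
    by (rule is_tambara_image[OF R quot proj_nat_trans]) (simp add: proj_surj)
  have univ: "\<exists>!h. h \<in> nat_trans ?B set_cat quot S \<and> Cmp (functor_cat ?B set_cat) R quot S h proj = \<eta>"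
    if k: "(S, \<eta>) \<in> K" for S \<eta>
  proof (rule proj_universal)
    show "\<eta> X a = \<eta> X b" if "(a, b) \<in> joint_kernel R K X" for X a b
      using that k unfolding joint_kernel_def by blast
  qed (use K[OF k] in auto)
  have clar: "clarified G \<Lambda> quot"
  proof (rule clarified_if_jointly_faithful[OF assms(1,2) _ quot])
    show "carrier G \<in> \<Lambda>" by (rule carrier_mem_if_upward_closed[OF assms(1,3-5)])
    let ?K = "{(S, h). is_tambara G S \<and> clarified G \<Lambda> S \<and> h \<in> nat_trans ?B set_cat quot S}"
    show "product_functor G S \<and> clarified G \<Lambda> S \<and> h \<in> nat_trans ?B set_cat quot S"
      if "(S, h) \<in> ?K" for S h
      using that by (simp add: is_tambara_def)
    let ?O = "free_orbit G"
    have O: "?O \<in> Obj ?B" using fin_gset_free_orbit[OF assms(1,2)] by simp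
    fix a b
    assume ab: "a \<in> fobj quot ?O" "b \<in> fobj quot ?O"
      and eq: "\<And>S h. (S, h) \<in> ?K \<Longrightarrow> h ?O a = h ?O b"
    obtain a' b' where a': "a' \<in> fobj R ?O" "a = proj ?O a'" and b': "b' \<in> fobj R ?O" "b = proj ?O b'"
      using ab unfolding proj_surj[OF O] by blast
    have "\<eta> ?O a' = \<eta> ?O b'" if k: "(S, \<eta>) \<in> K" for S \<eta>
    proof -
      obtain h where h: "h \<in> nat_trans ?B set_cat quot S"
        and c: "Cmp (functor_cat ?B set_cat) R quot S h proj = \<eta>" using univ[OF k] by blast
      have "\<eta> ?O c = h ?O (proj ?O c)" if "c \<in> fobj R ?O" for c
        using that O unfolding c[symmetric] by (simp add: functor_cat_def set_cat_def compose_def)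
      moreover have "is_tambara G S" "clarified G \<Lambda> S" using k by (simp_all add: K_def)
      then have "h ?O a = h ?O b" using h by (intro eq[of S h]) simp
      ultimately show ?thesis using a' b' by simp
    qed
    \<comment> \<open>every member of \<open>K\<close> factors through the quotient, so elements of the quotient that all
      morphisms identify come from elements related by the joint kernel\<close>
    then have "(a', b') \<in> joint_kernel R K ?O" using a' b' by (simp add: joint_kernel_def)
    then show "a = b" using a' b' proj_eq_iff[OF O] by simp
  qed
  show "\<exists>Q u. Q \<in> Obj ?T \<inter> {R. clarified G \<Lambda> R} \<and> u \<in> Hom ?T R Q \<and>
      (\<forall>S\<in>Obj ?T \<inter> {R. clarified G \<Lambda> R}. \<forall>\<eta>\<in>Hom ?T R S. \<exists>!h. h \<in> Hom ?T Q S \<and> Cmp ?T R Q S h u = \<eta>)"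
  proof (intro exI[of _ quot] exI[of _ proj] conjI ballI)
    show "quot \<in> Obj ?T \<inter> {R. clarified G \<Lambda> R}" using tamb clar by (simp add: Obj)
    show "proj \<in> Hom ?T R quot" unfolding Hom by (rule proj_nat_trans)
    fix S \<eta> assume "S \<in> Obj ?T \<inter> {R. clarified G \<Lambda> R}" "\<eta> \<in> Hom ?T R S"
    then have "(S, \<eta>) \<in> K" by (simp add: K_def Obj Hom)
    then show "\<exists>!h. h \<in> Hom ?T quot S \<and> Cmp ?T R quot S h proj = \<eta>"
      unfolding Hom Cmp by (rule univ)
  qed
qed

end
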